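(* Let $X$ be a simplicial group. The homotopy groups of the fundamental simplicial groups of $X$ are as follows. 1. For all $n\ge 0$, $$\pi_i(\Pi^{n\geq}(X))=\pi_i(\Pi^{\geq n+1}(X))=\begin{cases}\pi_i(X) & i\ge n+1\\ 0 & n+1>i.\end{cases}$$ 2. For all $n\ge 0$, $$\pi_i(\Pi_{n\geq}(X))=\pi_i(\Pi_{\geq n+1}(X))=\begin{cases}0 & i\ge n+1\\ \pi_i(X) & n+1>i.\end{cases}$$ 3. For all $n\ge 0$, $\pi_i(\Pi^{n\geq}_{\geq n+1}(X))=0$ for all $i$. 4. For $m>n\ge 0$, $$\pi_i(\Pi^{n\geq}_{\geq m+1}(X))=\begin{cases}\pi_i(X) & m+1>i\ge n+1\\ 0 & \text{otherwise.}\end{cases}$$ 5. Moreover, for $m>n\ge 0$ and for all $i$, $$\pi_i(\Pi^{n\geq}_{\geq m+1}(X))=\pi_i(\Pi^{n\geq}_{m\geq}(X))=\pi_i(\Pi^{\geq n+1}_{\geq m+1}(X))=\pi_i(\Pi^{\geq n+1}_{m\geq}(X)).$$ 6. In particular, for $m=n+1$, $$\pi_i(\Pi^{n\geq}_{\geq n+2}(X))=\begin{cases}\pi_i(X) & i=n+1\\ 0 & i\ne n+1.\end{cases}$$ (Equality of homotopy groups means isomorphism.)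
   Context: $Simp(Grp)$ is the category of simplicial groups, with face maps $d_i$. The Moore complex $N(X)$ is $N(X)_0=X_0$, $N(X)_k=\bigcap_{i=0}^{k-1}\ker(d_i:X_k\to X_{k-1})$ for $k\ge1$, with differential $\delta_k$ the restriction of $d_k$; the homotopy groups are $\pi_i(X)=H_i(N(X))$. For $n\ge 0$, $\mathcal{M}_{n\geq}$ is the full subcategory of simplicial groups with $N(X)_i=0$ for $i>n$, and $Cot_n$ is the left adjoint of the inclusion $\mathcal{M}_{n\geq}\to Simp(Grp)$ (it exists, its unit is a regular epimorphism, and $N(Cot_n(X))$ is $N(X)$ with $N(X)_n$ replaced by $N(X)_n/\delta_{n+1}(N(X)_{n+1})$ and $N(X)_i$ by $0$ for $i>n$). Set $\mu_{n\geq}(X)=\ker(X\to Cot_n(X))$, the kernel of the unit. For $n\ge 1$, set $\mu_{\geq n}(X)=\ker(X\to cosk_{n-1}tr_{n-1}(X))$, the kernel of the unit of the adjunction $tr_{n-1}\dashv cosk_{n-1}$ between simplicial groups and $(n-1)$-truncated simplicial groups. These are normal simplicial subgroups of $X$, functorial in $X$, and are the idempotent radicals of torsion theories in $Simp(Grp)$; they satisfy $\dots\le\mu_{n+1\geq}\le\mu_{\geq n+1}\le\mu_{n\geq}\le\mu_{\geq n}\le\dots$. The fundamental simplicial groups of $X$ are the following quotients, where each quotient $\sigma/\tau$ of two of these radicals is defined whenever $\tau\le\sigma$ in the linear order $\dots\le\mu_{n+1\geq}\le\mu_{\geq n+1}\le\mu_{n\geq}\le\mu_{\geq n}\le\dots$,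 and $(\sigma/\tau)(X)=\sigma(X)/\tau(X)$: $\Pi^{\geq n}_{m\geq}=\mu_{\geq n}/\mu_{m\geq}$, $\Pi^{n\geq}_{\geq m}=\mu_{n\geq}/\mu_{\geq m}$, $\Pi^{\geq n}_{\geq m}=\mu_{\geq n}/\mu_{\geq m}$, $\Pi^{n\geq}_{m\geq}=\mu_{n\geq}/\mu_{m\geq}$, $\Pi^{\geq n}=\mu_{\geq n}$, $\Pi^{n\geq}=\mu_{n\geq}$, $\Pi_{\geq n}=Id/\mu_{\geq n}$, $\Pi_{n\geq}=Id/\mu_{n\geq}$, each evaluated at $X$. *)

theory Defs
  imports "HOL-Algebra.Product_Groups"
begin

section \<open>Simplicial groups\<close>

text \<open>
  The simplex category has the objects \<open>[k] = {0,\<dots>,k}\<close>; its morphisms are the monotone maps,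
  made extensional (\<open>undefined\<close> outside \<open>[j]\<close>) so that equality of functions is equality of
  morphisms. A simplicial group is a contravariant functor from it to groups.
\<close>

definition Delta :: "nat \<Rightarrow> nat \<Rightarrow> (nat \<Rightarrow> nat) set" where
  "Delta j k = {\<theta> \<in> {..j} \<rightarrow>\<^sub>E {..k}. mono_on {..j} \<theta>}"

definition Delta_id :: "nat \<Rightarrow> nat \<Rightarrow> nat" where
  "Delta_id k = (\<lambda>i\<in>{..k}. i)"

definition coface :: "nat \<Rightarrow> nat \<Rightarrow> nat \<Rightarrow> nat" where
  "coface k i = (\<lambda>l\<in>{..k - 1}. if l < i then l else l + 1)"

text \<open>
  \<open>lev X k\<close> is the group of \<open>k\<close>-simplices; for \<open>\<theta> : [j] \<rightarrow> [k]\<close>, \<open>act X j k \<theta>\<close> is the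
  induced map from \<open>lev X k\<close> to \<open>lev X j\<close>.
\<close>

record 'a sgrp =
  lev :: "nat \<Rightarrow> 'a monoid"
  act :: "nat \<Rightarrow> nat \<Rightarrow> (nat \<Rightarrow> nat) \<Rightarrow> 'a \<Rightarrow> 'a"

text \<open>
  The set \<open>I\<close> of dimensions is \<open>UNIV\<close> for simplicial groups and \<open>{..n}\<close> for \<open>n\<close>-truncated ones;
  data in dimensions outside \<open>I\<close> is irrelevant.
\<close>

definition simplicial_group_on :: "nat set \<Rightarrow> 'a sgrp \<Rightarrow> bool" where
  "simplicial_group_on I X \<longleftrightarrow>
     (\<forall>k\<in>I. group (lev X k)) \<and>
     (\<forall>j\<in>I. \<forall>k\<in>I. \<forall>\<theta>\<in>Delta j k. act X j k \<theta> \<in> hom (lev X k) (lev X j)) \<and>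
     (\<forall>k\<in>I. \<forall>x\<in>carrier (lev X k). act X k k (Delta_id k) x = x) \<and>
     (\<forall>i\<in>I. \<forall>j\<in>I. \<forall>k\<in>I. \<forall>\<phi>\<in>Delta i j. \<forall>\<theta>\<in>Delta j k. \<forall>x\<in>carrier (lev X k).
        act X i k (compose {..i} \<theta> \<phi>) x = act X i j \<phi> (act X j k \<theta> x))"

definition shom_on :: "nat set \<Rightarrow> 'a sgrp \<Rightarrow> 'b sgrp \<Rightarrow> (nat \<Rightarrow> 'a \<Rightarrow> 'b) \<Rightarrow> bool" where
  "shom_on I X Y f \<longleftrightarrow>
     (\<forall>k\<in>I. f k \<in> hom (lev X k) (lev Y k)) \<and>
     (\<forall>j\<in>I. \<forall>k\<in>I. \<forall>\<theta>\<in>Delta j k. \<forall>x\<in>carrier (lev X k).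
        f j (act X j k \<theta> x) = act Y j k \<theta> (f k x))"

abbreviation simplicial_group :: "'a sgrp \<Rightarrow> bool" where
  "simplicial_group \<equiv> simplicial_group_on UNIV"

abbreviation shom :: "'a sgrp \<Rightarrow> 'b sgrp \<Rightarrow> (nat \<Rightarrow> 'a \<Rightarrow> 'b) \<Rightarrow> bool" where
  "shom \<equiv> shom_on UNIV"

lemma simplicial_group_onD:
  assumes "simplicial_group_on I X"
  shows "\<And>k. k \<in> I \<Longrightarrow> group (lev X k)"
    and "\<And>j k \<theta>. \<lbrakk>j \<in> I; k \<in> I; \<theta> \<in> Delta j k\<rbrakk> \<Longrightarrow> act X j k \<theta> \<in> hom (lev X k) (lev X j)"
    and "\<And>k x. \<lbrakk>k \<in> I; x \<in> carrier (lev X k)\<rbrakk> \<Longrightarrow> act X k k (Delta_id k) x = x"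
    and "\<And>i j k \<phi> \<theta> x. \<lbrakk>i \<in> I; j \<in> I; k \<in> I; \<phi> \<in> Delta i j; \<theta> \<in> Delta j k; x \<in> carrier (lev X k)\<rbrakk>
           \<Longrightarrow> act X i k (compose {..i} \<theta> \<phi>) x = act X i j \<phi> (act X j k \<theta> x)"
  using assms unfolding simplicial_group_on_def by blast+

lemma shom_onD:
  assumes "shom_on I X Y f"
  shows "\<And>k. k \<in> I \<Longrightarrow> f k \<in> hom (lev X k) (lev Y k)"
    and "\<And>j k \<theta> x. \<lbrakk>j \<in> I; k \<in> I; \<theta> \<in> Delta j k; x \<in> carrier (lev X k)\<rbrakk>
           \<Longrightarrow> f j (act X j k \<theta> x) = act Y j k \<theta> (f k x)"
  using assms unfolding shom_on_def by blast+

lemma shom_on_comp: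
  assumes "shom_on I X Y f" "shom_on I Y Z g"
  shows "shom_on I X Z (\<lambda>k x. g k (f k x))"
  unfolding shom_on_def
proof (intro conjI ballI)
  fix k assume k: "k \<in> I"
  show "(\<lambda>x. g k (f k x)) \<in> hom (lev X k) (lev Z k)"
    using hom_compose[OF shom_onD(1)[OF assms(1) k] shom_onD(1)[OF assms(2) k]]
    by (simp add: comp_def)
next
  fix j k \<theta> x assume "j \<in> I" "k \<in> I" "\<theta> \<in> Delta j k" "x \<in> carrier (lev X k)"
  then show "g j (f j (act X j k \<theta> x)) = act Z j k \<theta> (g k (f k x))"
    using shom_onD[OF assms(1)] shom_onD[OF assms(2)] by (metis hom_in_carrier)
qed

lemma Delta_id_in [simp]: "Delta_id k \<in> Delta k k"
  by (auto simp: Delta_def Delta_id_def mono_on_def)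

lemma Delta_mem: "\<theta> \<in> Delta j k \<Longrightarrow> i \<le> j \<Longrightarrow> \<theta> i \<le> k"
  by (auto simp: Delta_def)

lemma Delta_compose:
  assumes "\<phi> \<in> Delta i j" "\<theta> \<in> Delta j k"
  shows "compose {..i} \<theta> \<phi> \<in> Delta i k"
  using assms unfolding Delta_def mono_on_def compose_def
  by (auto simp: PiE_iff)

lemma Delta_compose_id_right:
  assumes "\<theta> \<in> Delta j k" shows "compose {..j} \<theta> (Delta_id j) = \<theta>"
  using assms by (auto simp: Delta_def Delta_id_def compose_def PiE_iff extensional_def)

lemma Delta_compose_id_left:
  assumes "\<theta> \<in> Delta j k" shows "compose {..j} (Delta_id k) \<theta> = \<theta>"
  using assms by (auto simp: Delta_def Delta_id_def compose_def PiE_iff extensional_def Pi_iff)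

lemma Delta_compose_assoc:
  assumes "\<psi> \<in> Delta h i"
  shows "compose {..h} (compose {..i} \<theta> \<phi>) \<psi> = compose {..h} \<theta> (compose {..h} \<phi> \<psi>)"
  using assms by (auto simp: Delta_def compose_def fun_eq_iff PiE_iff Pi_iff)

lemma coface_in [simp]: "k > 0 \<Longrightarrow> i \<le> k \<Longrightarrow> coface k i \<in> Delta (k - Suc 0) k"
  by (auto simp: Delta_def coface_def mono_on_def)


text \<open>The face map \<open>d\<^sub>i : X\<^sub>k \<rightarrow> X\<^sub>k\<^sub>-\<^sub>1\<close>, used only for \<open>k \<ge> 1\<close>.\<close>

definition face :: "'a sgrp \<Rightarrow> nat \<Rightarrow> nat \<Rightarrow> 'a \<Rightarrow> 'a" where
  "face X k i = act X (k - 1) k (coface k i)"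


section \<open>Moore complex and homotopy groups\<close>

definition moore :: "'a sgrp \<Rightarrow> nat \<Rightarrow> 'a monoid" where
  "moore X k = (lev X k)\<lparr>carrier := {x \<in> carrier (lev X k). \<forall>i<k. face X k i x = \<one>\<^bsub>lev X (k - 1)\<^esub>}\<rparr>"

definition moore_diff :: "'a sgrp \<Rightarrow> nat \<Rightarrow> 'a \<Rightarrow> 'a" where
  "moore_diff X k = face X k k"

definition moore_cycles :: "'a sgrp \<Rightarrow> nat \<Rightarrow> 'a set" where
  "moore_cycles X k =
     (if k = 0 then carrier (moore X k) else kernel (moore X k) (moore X (k - 1)) (moore_diff X k))"

definition moore_boundaries :: "'a sgrp \<Rightarrow> nat \<Rightarrow> 'a set" where
  "moore_boundaries X k = moore_diff X (Suc k) ` carrier (moore X (Suc k))"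

definition homotopy_group :: "nat \<Rightarrow> 'a sgrp \<Rightarrow> 'a set monoid" where
  "homotopy_group i X = (lev X i)\<lparr>carrier := moore_cycles X i\<rparr> Mod moore_boundaries X i"


section \<open>Normal simplicial subgroups and quotients\<close>

definition skernel :: "'a sgrp \<Rightarrow> 'b sgrp \<Rightarrow> (nat \<Rightarrow> 'a \<Rightarrow> 'b) \<Rightarrow> nat \<Rightarrow> 'a set" where
  "skernel X Y f k = kernel (lev X k) (lev Y k) (f k)"

definition normal_simplicial_subgroup :: "'a sgrp \<Rightarrow> (nat \<Rightarrow> 'a set) \<Rightarrow> bool" where
  "normal_simplicial_subgroup X T \<longleftrightarrow>
     (\<forall>k. T k \<lhd> lev X k) \<and> (\<forall>j k. \<forall>\<theta>\<in>Delta j k. act X j k \<theta> ` T k \<subseteq> T j)"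

definition ssub :: "'a sgrp \<Rightarrow> (nat \<Rightarrow> 'a set) \<Rightarrow> 'a sgrp" where
  "ssub X S = \<lparr>lev = (\<lambda>k. (lev X k)\<lparr>carrier := S k\<rparr>), act = act X\<rparr>"

text \<open>
  The action sends a coset \<open>C\<close> of \<open>T k\<close> to the coset of \<open>T j\<close> containing the image of \<open>C\<close>;
  see \<open>act_squot_coset\<close> below.
\<close>

definition squot :: "'a sgrp \<Rightarrow> (nat \<Rightarrow> 'a set) \<Rightarrow> 'a set sgrp" where
  "squot X T = \<lparr>lev = (\<lambda>k. lev X k Mod T k),
                act = (\<lambda>j k \<theta> C. T j <#>\<^bsub>lev X j\<^esub> (act X j k \<theta> ` C))\<rparr>"


section \<open>The reflection \<open>Cot\<close>\<close>

text \<open>The full subcategory of simplicial groups whose Moore complex vanishes above dimension \<open>n\<close>.\<close>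

definition in_M :: "nat \<Rightarrow> 'a sgrp \<Rightarrow> bool" where
  "in_M n X \<longleftrightarrow> simplicial_group X \<and> (\<forall>i>n. carrier (moore X i) = {\<one>\<^bsub>lev X i\<^esub>})"

definition factors_uniquely ::
  "'a sgrp \<Rightarrow> 'c sgrp \<Rightarrow> (nat \<Rightarrow> 'a \<Rightarrow> 'c) \<Rightarrow> 'b sgrp \<Rightarrow> (nat \<Rightarrow> 'a \<Rightarrow> 'b) \<Rightarrow> bool" where
  "factors_uniquely X C \<eta> Y f \<longleftrightarrow>
     (\<exists>g. shom C Y g \<and> (\<forall>k. \<forall>x\<in>carrier (lev X k). g k (\<eta> k x) = f k x)) \<and>
     (\<forall>g g'. shom C Y g \<and> (\<forall>k. \<forall>x\<in>carrier (lev X k). g k (\<eta> k x) = f k x) \<and>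
             shom C Y g' \<and> (\<forall>k. \<forall>x\<in>carrier (lev X k). g' k (\<eta> k x) = f k x)
        \<longrightarrow> (\<forall>k. \<forall>c\<in>carrier (lev C k). g k c = g' k c))"

lemma normal_simplicial_subgroupD:
  assumes "normal_simplicial_subgroup X T"
  shows "T k \<lhd> lev X k"
    and "\<theta> \<in> Delta j k \<Longrightarrow> x \<in> T k \<Longrightarrow> act X j k \<theta> x \<in> T j"
  using assms unfolding normal_simplicial_subgroup_def by blast+

lemma normal_simplicial_subgroup_skernel:
  assumes X: "simplicial_group X" and Y: "simplicial_group Y" and f: "shom X Y f"
  shows "normal_simplicial_subgroup X (skernel X Y f)"
proof -
  have gh: "group_hom (lev X k) (lev Y k) (f k)" for k
    using simplicial_group_onD(1)[OF X] simplicial_group_onD(1)[OF Y] shom_onD(1)[OF f]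
    by (simp add: group_hom_def group_hom_axioms_def)
  have "act X j k \<theta> x \<in> skernel X Y f j" if t: "\<theta> \<in> Delta j k" and x: "x \<in> skernel X Y f k" for j k \<theta> x
  proof -
    have xc: "x \<in> carrier (lev X k)" and fx: "f k x = \<one>\<^bsub>lev Y k\<^esub>"
      using x by (auto simp: skernel_def kernel_def)
    have "f j (act X j k \<theta> x) = act Y j k \<theta> (f k x)"
      using shom_onD(2)[OF f _ _ t xc] by simp
    also have "\<dots> = \<one>\<^bsub>lev Y j\<^esub>"
      unfolding fx using hom_one[OF simplicial_group_onD(2)[OF Y _ _ t]] simplicial_group_onD(1)[OF Y]
      by simp
    finally show ?thesis
      using hom_in_carrier[OF simplicial_group_onD(2)[OF X _ _ t] xc]
      by (simp add: skernel_def kernel_def)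
  qed
  then show ?thesis
    unfolding normal_simplicial_subgroup_def
    using group_hom.normal_kernel[OF gh] by (auto simp: skernel_def)
qed

lemma act_squot_coset:
  assumes X: "simplicial_group X" and T: "normal_simplicial_subgroup X T"
    and t: "\<theta> \<in> Delta j k" and x: "x \<in> carrier (lev X k)"
  shows "act (squot X T) j k \<theta> (T k #>\<^bsub>lev X k\<^esub> x) = T j #>\<^bsub>lev X j\<^esub> act X j k \<theta> x"
proof -
  let ?a = "act X j k \<theta>"
  interpret K: normal "T k" "lev X k" by (rule normal_simplicial_subgroupD(1)[OF T])
  interpret J: normal "T j" "lev X j" by (rule normal_simplicial_subgroupD(1)[OF T])
  have h: "?a \<in> hom (lev X k) (lev X j)" using simplicial_group_onD(2)[OF X _ _ t] by simp
  note aT = normal_simplicial_subgroupD(2)[OF T t]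
  have ax: "?a x \<in> carrier (lev X j)" by (rule hom_in_carrier[OF h x])
  have prod: "s \<otimes>\<^bsub>lev X j\<^esub> ?a (u \<otimes>\<^bsub>lev X k\<^esub> x) = (s \<otimes>\<^bsub>lev X j\<^esub> ?a u) \<otimes>\<^bsub>lev X j\<^esub> ?a x"
    if s: "s \<in> T j" and u: "u \<in> T k" for s u
    unfolding hom_mult[OF h K.mem_carrier[OF u] x]
    by (rule J.m_assoc[symmetric, OF J.mem_carrier[OF s] J.mem_carrier[OF aT[OF u]] ax])
  have "T j <#>\<^bsub>lev X j\<^esub> (?a ` (T k #>\<^bsub>lev X k\<^esub> x)) = T j #>\<^bsub>lev X j\<^esub> ?a x" (is "?L = ?R")
  proof
    show "?L \<subseteq> ?R"
    proof
      fix y assume "y \<in> ?L"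
      then obtain s u where su: "s \<in> T j" "u \<in> T k" "y = s \<otimes>\<^bsub>lev X j\<^esub> ?a (u \<otimes>\<^bsub>lev X k\<^esub> x)"
        unfolding set_mult_def r_coset_def by blast
      have "y = (s \<otimes>\<^bsub>lev X j\<^esub> ?a u) \<otimes>\<^bsub>lev X j\<^esub> ?a x"
        unfolding su(3) by (rule prod[OF su(1,2)])
      moreover have "s \<otimes>\<^bsub>lev X j\<^esub> ?a u \<in> T j"
        by (rule subgroup.m_closed[OF J.subgroup_axioms su(1) aT[OF su(2)]])
      ultimately show "y \<in> ?R"
        unfolding r_coset_def by blast
    qed
    show "?R \<subseteq> ?L"
    proof
      fix y assume "y \<in> ?R"
      then obtain s where s: "s \<in> T j" "y = s \<otimes>\<^bsub>lev X j\<^esub> ?a x"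
        unfolding r_coset_def by blast
      have "y = s \<otimes>\<^bsub>lev X j\<^esub> ?a (\<one>\<^bsub>lev X k\<^esub> \<otimes>\<^bsub>lev X k\<^esub> x)"
        unfolding s(2) K.l_one[OF x] ..
      moreover have "\<one>\<^bsub>lev X k\<^esub> \<otimes>\<^bsub>lev X k\<^esub> x \<in> T k #>\<^bsub>lev X k\<^esub> x"
        unfolding r_coset_def using subgroup.one_closed[OF K.subgroup_axioms] by blast
      ultimately show "y \<in> ?L"
        unfolding set_mult_def using s(1) by auto
    qed
  qed
  then show ?thesis by (simp add: squot_def)
qed

lemma carrier_squot: "carrier (lev (squot X T) k) = (\<lambda>x. T k #>\<^bsub>lev X k\<^esub> x) ` carrier (lev X k)"
  by (auto simp: squot_def FactGroup_def RCOSETS_def)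

lemma one_squot: "\<one>\<^bsub>lev (squot X T) k\<^esub> = T k"
  by (simp add: squot_def FactGroup_def)

lemma proj_squot_hom:
  assumes "normal_simplicial_subgroup X T"
  shows "(\<lambda>x. T k #>\<^bsub>lev X k\<^esub> x) \<in> hom (lev X k) (lev (squot X T) k)"
  using normal.r_coset_hom_Mod[OF normal_simplicial_subgroupD(1)[OF assms]] by (simp add: squot_def)

lemma simplicial_group_squot:
  assumes X: "simplicial_group X" and T: "normal_simplicial_subgroup X T"
  shows "simplicial_group (squot X T)"
proof -
  note act = act_squot_coset[OF X T]
  note closed = hom_in_carrier[OF simplicial_group_onD(2)[OF X]]
  note p = proj_squot_hom[OF T]
  have hom: "act (squot X T) j k \<theta> \<in> hom (lev (squot X T) k) (lev (squot X T) j)"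
    if t: "\<theta> \<in> Delta j k" for j k \<theta>
  proof (rule homI)
    fix C assume "C \<in> carrier (lev (squot X T) k)"
    then obtain x where x: "x \<in> carrier (lev X k)" "C = T k #>\<^bsub>lev X k\<^esub> x"
      by (auto simp: carrier_squot)
    show "act (squot X T) j k \<theta> C \<in> carrier (lev (squot X T) j)"
      unfolding x(2) act[OF t x(1)] carrier_squot
      by (intro imageI closed[OF _ _ t x(1)]) auto
  next
    fix C D assume "C \<in> carrier (lev (squot X T) k)" "D \<in> carrier (lev (squot X T) k)"
    then obtain x y where x: "x \<in> carrier (lev X k)" "C = T k #>\<^bsub>lev X k\<^esub> x"
      and y: "y \<in> carrier (lev X k)" "D = T k #>\<^bsub>lev X k\<^esub> y"
      by (auto simp: carrier_squot)
    have xy: "x \<otimes>\<^bsub>lev X k\<^esub> y \<in> carrier (lev X k)"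
      using x y simplicial_group_onD(1)[OF X, of k] by (simp add: group.is_monoid monoid.m_closed)
    have "act (squot X T) j k \<theta> (C \<otimes>\<^bsub>lev (squot X T) k\<^esub> D)
        = act (squot X T) j k \<theta> (T k #>\<^bsub>lev X k\<^esub> (x \<otimes>\<^bsub>lev X k\<^esub> y))"
      unfolding x(2) y(2) hom_mult[OF p x(1) y(1)] ..
    also have "\<dots> = T j #>\<^bsub>lev X j\<^esub> (act X j k \<theta> x \<otimes>\<^bsub>lev X j\<^esub> act X j k \<theta> y)"
      unfolding act[OF t xy] by (simp add: hom_mult[OF simplicial_group_onD(2)[OF X _ _ t] x(1) y(1)])
    also have "\<dots> = act (squot X T) j k \<theta> C \<otimes>\<^bsub>lev (squot X T) j\<^esub> act (squot X T) j k \<theta> D"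
      unfolding x(2) y(2) act[OF t x(1)] act[OF t y(1)]
      by (intro hom_mult[OF p] closed[OF _ _ t x(1)] closed[OF _ _ t y(1)]) auto
    finally show "act (squot X T) j k \<theta> (C \<otimes>\<^bsub>lev (squot X T) k\<^esub> D)
        = act (squot X T) j k \<theta> C \<otimes>\<^bsub>lev (squot X T) j\<^esub> act (squot X T) j k \<theta> D" .
  qed
  have grp: "group (lev (squot X T) k)" for k
    using normal.factorgroup_is_group[OF normal_simplicial_subgroupD(1)[OF T]] by (simp add: squot_def)
  have id: "act (squot X T) k k (Delta_id k) C = C" if C: "C \<in> carrier (lev (squot X T) k)" for k C
  proof -
    obtain x where x: "x \<in> carrier (lev X k)" "C = T k #>\<^bsub>lev X k\<^esub> x"
      using C by (auto simp: carrier_squot)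
    show ?thesis
      unfolding x(2) act[OF Delta_id_in x(1)] by (simp add: simplicial_group_onD(3)[OF X _ x(1)])
  qed
  have comp: "act (squot X T) i k (compose {..i} \<theta> \<phi>) C = act (squot X T) i j \<phi> (act (squot X T) j k \<theta> C)"
    if ph: "\<phi> \<in> Delta i j" and t: "\<theta> \<in> Delta j k" and C: "C \<in> carrier (lev (squot X T) k)" for i j k \<phi> \<theta> C
  proof -
    obtain x where x: "x \<in> carrier (lev X k)" "C = T k #>\<^bsub>lev X k\<^esub> x"
      using C by (auto simp: carrier_squot)
    show ?thesis
      unfolding x(2) act[OF Delta_compose[OF ph t] x(1)] act[OF t x(1)]
      by (simp add: act[OF ph closed[OF _ _ t x(1)]] simplicial_group_onD(4)[OF X _ _ _ ph t x(1)])
  qed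
  show ?thesis
    unfolding simplicial_group_on_def by (intro conjI ballI grp hom id comp)
qed

lemma shom_proj_squot:
  assumes "simplicial_group X" "normal_simplicial_subgroup X T"
  shows "shom X (squot X T) (\<lambda>k x. T k #>\<^bsub>lev X k\<^esub> x)"
  unfolding shom_on_def using proj_squot_hom[OF assms(2)] act_squot_coset[OF assms] by simp

lemma factor_squot:
  assumes X: "simplicial_group X" and Y: "simplicial_group Y" and T: "normal_simplicial_subgroup X T"
    and f: "shom X Y f" and le: "\<And>k. T k \<subseteq> skernel X Y f k"
  shows "factors_uniquely X (squot X T) (\<lambda>k x. T k #>\<^bsub>lev X k\<^esub> x) Y f"
proof -
  have "\<exists>g. g \<in> hom (lev X k Mod T k) (lev Y k) \<and> (\<forall>x\<in>carrier (lev X k). g (T k #>\<^bsub>lev X k\<^esub> x) = f k x)" for k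
  proof -
    have gh: "group_hom (lev X k) (lev Y k) (f k)"
      using simplicial_group_onD(1)[OF X] simplicial_group_onD(1)[OF Y] shom_onD(1)[OF f]
      by (simp add: group_hom_def group_hom_axioms_def)
    show ?thesis
      using group_hom.FactGroup_universal_kernel[OF gh normal_simplicial_subgroupD(1)[OF T]] le
      by (metis skernel_def)
  qed
  then obtain g where g: "\<And>k. g k \<in> hom (lev X k Mod T k) (lev Y k)"
      "\<And>k x. x \<in> carrier (lev X k) \<Longrightarrow> g k (T k #>\<^bsub>lev X k\<^esub> x) = f k x"
    by metis
  have "g j (act (squot X T) j k \<theta> C) = act Y j k \<theta> (g k C)"
    if t: "\<theta> \<in> Delta j k" and C: "C \<in> carrier (lev (squot X T) k)" for j k \<theta> C
  proof -
    obtain x where x: "x \<in> carrier (lev X k)" "C = T k #>\<^bsub>lev X k\<^esub> x"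
      using C by (auto simp: carrier_squot)
    show ?thesis
      using act_squot_coset[OF X T t x(1)] g(2) x hom_in_carrier[OF simplicial_group_onD(2)[OF X _ _ t] x(1)]
        shom_onD(2)[OF f _ _ t x(1)] by simp
  qed
  moreover have "g k \<in> hom (lev (squot X T) k) (lev Y k)" for k
    using g(1) by (simp add: squot_def)
  ultimately have "shom (squot X T) Y g"
    unfolding shom_on_def by simp
  then show ?thesis
    unfolding factors_uniquely_def using g(2) by (auto simp: carrier_squot)
qed

text \<open>
  \<open>Cot n X\<close> is the value at \<open>X\<close> of the left adjoint of the inclusion of \<open>in_M n\<close>, that is,
  a universal arrow from \<open>X\<close> to this inclusion. A definition cannot quantify over types, so
  universality is required here for targets over the type \<open>'a set\<close>, which carries the quotients
  of \<open>X\<close>. Below it is shown that such an arrow exists (\<open>is_Cot_Cot\<close>) and is universal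
  for targets over every type (\<open>Cot_universal\<close>).
\<close>

definition is_Cot :: "nat \<Rightarrow> 'a sgrp \<Rightarrow> 'a set sgrp \<Rightarrow> (nat \<Rightarrow> 'a \<Rightarrow> 'a set) \<Rightarrow> bool" where
  "is_Cot n X C \<eta> \<longleftrightarrow> in_M n C \<and> shom X C \<eta> \<and>
     (\<forall>(Y::'a set sgrp) f. in_M n Y \<and> shom X Y f \<longrightarrow> factors_uniquely X C \<eta> Y f)"

definition Cot_arrow :: "nat \<Rightarrow> 'a sgrp \<Rightarrow> 'a set sgrp \<times> (nat \<Rightarrow> 'a \<Rightarrow> 'a set)" where
  "Cot_arrow n X = (SOME p. is_Cot n X (fst p) (snd p))"

definition Cot :: "nat \<Rightarrow> 'a sgrp \<Rightarrow> 'a set sgrp" where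
  "Cot n X = fst (Cot_arrow n X)"

definition Cot_unit :: "nat \<Rightarrow> 'a sgrp \<Rightarrow> nat \<Rightarrow> 'a \<Rightarrow> 'a set" where
  "Cot_unit n X = snd (Cot_arrow n X)"


lemma factors_uniquelyE:
  assumes "factors_uniquely X C \<eta> Y f"
  obtains g where "shom C Y g" "\<And>k x. x \<in> carrier (lev X k) \<Longrightarrow> g k (\<eta> k x) = f k x"
  using assms unfolding factors_uniquely_def by metis

lemma factors_uniquely_unique:
  assumes "factors_uniquely X C \<eta> Y f"
    and "shom C Y g" "\<And>k x. x \<in> carrier (lev X k) \<Longrightarrow> g k (\<eta> k x) = f k x"
    and "shom C Y g'" "\<And>k x. x \<in> carrier (lev X k) \<Longrightarrow> g' k (\<eta> k x) = f k x"
    and "c \<in> carrier (lev C k)"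
  shows "g k c = g' k c"
proof -
  have "\<forall>k. \<forall>c\<in>carrier (lev C k). g k c = g' k c"
    by (rule conjunct2[OF assms(1)[unfolded factors_uniquely_def],
        THEN spec[of _ g], THEN spec[of _ g'], THEN mp]) (simp add: assms)
  then show ?thesis using assms(6) by blast
qed

lemma in_M_sub:
  assumes X: "simplicial_group X" and T: "normal_simplicial_subgroup X T"
    and *: "\<And>k x. \<lbrakk>k > n; x \<in> carrier (lev X k); \<And>i. i < k \<Longrightarrow> face X k i x \<in> T (k - 1)\<rbrakk> \<Longrightarrow> x \<in> T k"
  shows "in_M n (squot X T)"
proof -
  let ?Q = "squot X T"
  have Q: "simplicial_group ?Q" by (rule simplicial_group_squot[OF X T])
  have "C = \<one>\<^bsub>lev ?Q k\<^esub>" if k: "k > n" and C: "C \<in> carrier (moore ?Q k)" for k C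
  proof -
    obtain x where x: "x \<in> carrier (lev X k)" "C = T k #>\<^bsub>lev X k\<^esub> x"
      using C by (auto simp: carrier_squot moore_def)
    have "face X k i x \<in> T (k - 1)" if i: "i < k" for i
    proof -
      have d: "coface k i \<in> Delta (k - 1) k" using i by simp
      have "act ?Q (k - 1) k (coface k i) C = T (k - 1)"
        using C i by (simp add: moore_def one_squot face_def)
      then have eq: "T (k - 1) #>\<^bsub>lev X (k - 1)\<^esub> face X k i x = T (k - 1)"
        using act_squot_coset[OF X T d x(1)] x(2) by (simp add: face_def)
      have fc: "face X k i x \<in> carrier (lev X (k - 1))"
        unfolding face_def using hom_in_carrier[OF simplicial_group_onD(2)[OF X _ _ d] x(1)] by simp
      have "subgroup (T (k - 1)) (lev X (k - 1))"
        using normal_imp_subgroup[OF normal_simplicial_subgroupD(1)[OF T]] .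
      then show ?thesis
        using group.rcos_self[OF simplicial_group_onD(1)[OF X] fc] eq by force
    qed
    then have "x \<in> T k" using *[OF k x(1)] by blast
    then show ?thesis
      using x group.coset_join2[OF simplicial_group_onD(1)[OF X] x(1)
          normal_imp_subgroup[OF normal_simplicial_subgroupD(1)[OF T]]]
      by (simp add: one_squot)
  qed
  moreover have "\<one>\<^bsub>lev ?Q k\<^esub> \<in> carrier (moore ?Q k)" for k
  proof -
    have "\<one>\<^bsub>lev ?Q k\<^esub> \<in> carrier (lev ?Q k)"
      using simplicial_group_onD(1)[OF Q, of k] by (simp add: group.is_monoid)
    moreover have "face ?Q k i \<one>\<^bsub>lev ?Q k\<^esub> = \<one>\<^bsub>lev ?Q (k - 1)\<^esub>" if "i < k" for i
      unfolding face_def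
      using that by (intro hom_one simplicial_group_onD[OF Q]) auto
    ultimately show ?thesis by (simp add: moore_def)
  qed
  ultimately show ?thesis
    unfolding in_M_def using Q by blast
qed

lemma in_M_squot_mem:
  assumes X: "simplicial_group X" and T: "normal_simplicial_subgroup X T" and M: "in_M n (squot X T)"
    and k: "k > n" and x: "x \<in> carrier (lev X k)" and d: "\<And>i. i < k \<Longrightarrow> face X k i x \<in> T (k - 1)"
  shows "x \<in> T k"
proof -
  note sub = normal_imp_subgroup[OF normal_simplicial_subgroupD(1)[OF T]]
  let ?C = "T k #>\<^bsub>lev X k\<^esub> x"
  have "?C \<in> carrier (moore (squot X T) k)"
    unfolding moore_def
  proof (simp, intro conjI allI impI)
    show "?C \<in> carrier (lev (squot X T) k)" using x by (simp add: carrier_squot)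
    fix i assume i: "i < k"
    then have "face (squot X T) k i ?C = T (k - 1) #>\<^bsub>lev X (k - 1)\<^esub> face X k i x"
      unfolding face_def by (intro act_squot_coset[OF X T _ x]) simp
    also have "\<dots> = T (k - 1)"
      using group.coset_join2[OF simplicial_group_onD(1)[OF X] subgroup.mem_carrier[OF sub d[OF i]] sub d[OF i]]
      by simp
    finally show "face (squot X T) k i ?C = \<one>\<^bsub>lev (squot X T) (k - Suc 0)\<^esub>" by (simp add: one_squot)
  qed
  then have "?C = T k" using M k by (auto simp: in_M_def one_squot)
  then show ?thesis
    using group.rcos_self[OF simplicial_group_onD(1)[OF X] x sub] by simp
qed

lemma in_M_squot_skernel:
  assumes X: "simplicial_group X" and Y: "in_M n Y" and f: "shom X Y f"
  shows "in_M n (squot X (skernel X Y f))"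
proof -
  have Ys: "simplicial_group Y" using Y by (simp add: in_M_def)
  show ?thesis
  proof (rule in_M_sub[OF X normal_simplicial_subgroup_skernel[OF X Ys f]])
    fix k x assume k: "k > n" and x: "x \<in> carrier (lev X k)"
      and d: "\<And>i. i < k \<Longrightarrow> face X k i x \<in> skernel X Y f (k - 1)"
    have "face Y k i (f k x) = \<one>\<^bsub>lev Y (k - 1)\<^esub>" if i: "i < k" for i
    proof -
      have "f (k - 1) (face X k i x) = face Y k i (f k x)"
        unfolding face_def using i by (intro shom_onD(2)[OF f _ _ _ x]) auto
      then show ?thesis using d[OF i] by (simp add: skernel_def kernel_def)
    qed
    then have "f k x \<in> carrier (moore Y k)"
      using hom_in_carrier[OF shom_onD(1)[OF f] x] by (simp add: moore_def)
    then show "x \<in> skernel X Y f k"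
      using Y k x by (auto simp: in_M_def skernel_def kernel_def)
  qed
qed

text \<open>The smallest normal simplicial subgroup with quotient in \<open>in_M n\<close>.\<close>

lemma universal_quotient:
  fixes X :: "'a sgrp"
  assumes X: "simplicial_group X"
  shows "\<exists>T. normal_simplicial_subgroup X T \<and> in_M n (squot X T) \<and>
    (\<forall>S. normal_simplicial_subgroup X S \<and> in_M n (squot X S) \<longrightarrow> (\<forall>k. T k \<subseteq> S k))"
proof -
  define F where "F = {S. normal_simplicial_subgroup X S \<and> in_M n (squot X S)}"
  define T where "T = (\<lambda>k. \<Inter>S\<in>F. S k)"
  have F: "S \<in> F \<Longrightarrow> normal_simplicial_subgroup X S" "S \<in> F \<Longrightarrow> in_M n (squot X S)" for S
    by (auto simp: F_def)
  have grp: "group (lev X k)" for k using simplicial_group_onD(1)[OF X] by simp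
  have top: "(\<lambda>k. carrier (lev X k)) \<in> F"
  proof -
    have norm: "carrier (lev X k) \<lhd> lev X k" for k
      using grp[of k] by (intro group.normal_invI group.subgroup_self)
        (auto simp: group.is_monoid monoid.m_closed)
    have "normal_simplicial_subgroup X (\<lambda>k. carrier (lev X k))"
      unfolding normal_simplicial_subgroup_def
      using norm hom_in_carrier[OF simplicial_group_onD(2)[OF X]] by blast
    then show ?thesis
      unfolding F_def using in_M_sub[OF X] by blast
  qed
  have norm: "T k \<lhd> lev X k" for k
  proof -
    have eq: "T k = \<Inter> ((\<lambda>S. S k) ` F)" by (simp add: T_def)
    have "subgroup (T k) (lev X k)"
      unfolding eq
      using top normal_imp_subgroup[OF normal_simplicial_subgroupD(1)[OF F(1)]]
      by (intro group.subgroups_Inter[OF grp]) auto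
    moreover have "x \<otimes>\<^bsub>lev X k\<^esub> h \<otimes>\<^bsub>lev X k\<^esub> inv\<^bsub>lev X k\<^esub> x \<in> T k"
      if "h \<in> T k" "x \<in> carrier (lev X k)" for h x
      using that normal.inv_op_closed2[OF normal_simplicial_subgroupD(1)[OF F(1)]]
      unfolding T_def by blast
    ultimately show ?thesis
      using group.normal_inv_iff[OF grp] by blast
  qed
  have T: "normal_simplicial_subgroup X T"
    unfolding normal_simplicial_subgroup_def
  proof (intro conjI allI ballI subsetI norm)
    fix j k \<theta> y assume "\<theta> \<in> Delta j k" "y \<in> act X j k \<theta> ` T k"
    then show "y \<in> T j"
      using normal_simplicial_subgroupD(2)[OF F(1)] unfolding T_def by blast
  qed
  have M: "in_M n (squot X T)"
  proof (rule in_M_sub[OF X T])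
    fix k x assume *: "k > n" "x \<in> carrier (lev X k)" "\<And>i. i < k \<Longrightarrow> face X k i x \<in> T (k - 1)"
    show "x \<in> T k"
      unfolding T_def
    proof
      fix S assume "S \<in> F"
      then show "x \<in> S k"
        using in_M_squot_mem[OF X F(1) F(2) *(1,2)] *(3) unfolding T_def by blast
    qed
  qed
  have "\<forall>S. normal_simplicial_subgroup X S \<and> in_M n (squot X S) \<longrightarrow> (\<forall>k. T k \<subseteq> S k)"
    unfolding T_def F_def by blast
  with T M show ?thesis by blast
qed

lemma universal_squot:
  assumes X: "simplicial_group X" and T: "normal_simplicial_subgroup X T"
    and least: "\<forall>S. normal_simplicial_subgroup X S \<and> in_M n (squot X S) \<longrightarrow> (\<forall>k. T k \<subseteq> S k)"
    and Y: "in_M n Y" and f: "shom X Y f"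
  shows "factors_uniquely X (squot X T) (\<lambda>k x. T k #>\<^bsub>lev X k\<^esub> x) Y f"
proof -
  have Ys: "simplicial_group Y" using Y by (simp add: in_M_def)
  have "T k \<subseteq> skernel X Y f k" for k
    using least normal_simplicial_subgroup_skernel[OF X Ys f] in_M_squot_skernel[OF X Y f] by blast
  then show ?thesis by (rule factor_squot[OF X Ys T f])
qed

theorem is_Cot_Cot:
  assumes X: "simplicial_group X"
  shows "is_Cot n X (Cot n X) (Cot_unit n X)"
proof -
  obtain T where T: "normal_simplicial_subgroup X T" "in_M n (squot X T)"
    and least: "\<forall>S. normal_simplicial_subgroup X S \<and> in_M n (squot X S) \<longrightarrow> (\<forall>k. T k \<subseteq> S k)"
    using universal_quotient[OF X, of n] by auto
  have "is_Cot n X (squot X T) (\<lambda>k x. T k #>\<^bsub>lev X k\<^esub> x)"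
    unfolding is_Cot_def
  proof (intro conjI allI impI T(2) shom_proj_squot[OF X T(1)])
    fix Y :: "'a set sgrp" and f assume "in_M n Y \<and> shom X Y f"
    then show "factors_uniquely X (squot X T) (\<lambda>k x. T k #>\<^bsub>lev X k\<^esub> x) Y f"
      by (intro universal_squot[OF X T(1) least]) auto
  qed
  then have "\<exists>p. is_Cot n X (fst p) (snd p)"
    by (intro exI[of _ "(squot X T, \<lambda>k x. T k #>\<^bsub>lev X k\<^esub> x)"]) simp
  then show ?thesis
    unfolding Cot_def Cot_unit_def Cot_arrow_def by (rule someI_ex)
qed

theorem Cot_universal:
  fixes X :: "'a sgrp" and Y :: "'b sgrp"
  assumes X: "simplicial_group X" and Y: "in_M n Y" and f: "shom X Y f"
  shows "factors_uniquely X (Cot n X) (Cot_unit n X) Y f"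
proof -
  let ?C = "Cot n X" and ?e = "Cot_unit n X"
  obtain T where T: "normal_simplicial_subgroup X T" "in_M n (squot X T)"
    and least: "\<forall>S. normal_simplicial_subgroup X S \<and> in_M n (squot X S) \<longrightarrow> (\<forall>k. T k \<subseteq> S k)"
    using universal_quotient[OF X, of n] by auto
  let ?Q = "squot X T" and ?q = "\<lambda>k x. T k #>\<^bsub>lev X k\<^esub> x"
  have q: "shom X ?Q ?q" by (rule shom_proj_squot[OF X T(1)])
  have C: "in_M n ?C" "shom X ?C ?e"
    and univ: "\<And>(Y :: 'a set sgrp) f. in_M n Y \<Longrightarrow> shom X Y f \<Longrightarrow> factors_uniquely X ?C ?e Y f"
    using is_Cot_Cot[OF X, of n] by (auto simp: is_Cot_def)
  obtain a where a: "shom ?C ?Q a" "\<And>k x. x \<in> carrier (lev X k) \<Longrightarrow> a k (?e k x) = ?q k x"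
    by (rule factors_uniquelyE[OF univ[OF T(2) q]]) blast
  obtain b where b: "shom ?Q ?C b" "\<And>k x. x \<in> carrier (lev X k) \<Longrightarrow> b k (?q k x) = ?e k x"
    by (rule factors_uniquelyE[OF universal_squot[OF X T(1) least C]]) blast
  have id: "shom ?C ?C (\<lambda>k x. x)"
    by (simp add: shom_on_def hom_def)
  have ba: "b k (a k c) = c" if "c \<in> carrier (lev ?C k)" for k c
    by (rule factors_uniquely_unique[OF univ[OF C] shom_on_comp[OF a(1) b(1)] _ id _ that])
      (simp_all add: a(2) b(2))
  obtain g where g: "shom ?Q Y g" "\<And>k x. x \<in> carrier (lev X k) \<Longrightarrow> g k (?q k x) = f k x"
    by (rule factors_uniquelyE[OF universal_squot[OF X T(1) least Y f]]) blast
  have "shom ?C Y (\<lambda>k c. g k (a k c))" by (rule shom_on_comp[OF a(1) g(1)])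
  moreover have "\<forall>k. \<forall>x\<in>carrier (lev X k). g k (a k (?e k x)) = f k x"
    using a(2) g(2) by simp
  moreover have "u k c = v k c"
    if u: "shom ?C Y u" "\<forall>k. \<forall>x\<in>carrier (lev X k). u k (?e k x) = f k x"
      and v: "shom ?C Y v" "\<forall>k. \<forall>x\<in>carrier (lev X k). v k (?e k x) = f k x"
      and c: "c \<in> carrier (lev ?C k)" for u v k c
  proof -
    have ac: "a k c \<in> carrier (lev ?Q k)"
      using hom_in_carrier[OF shom_onD(1)[OF a(1)] c] by simp
    then obtain x where x: "x \<in> carrier (lev X k)" "a k c = ?q k x"
      by (auto simp: carrier_squot)
    then have "c = ?e k x" using ba[OF c] b(2) by simp
    then show ?thesis using u(2) v(2) x(1) by simp
  qed
  ultimately show ?thesis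
    unfolding factors_uniquely_def by blast
qed


section \<open>Truncation and coskeleton\<close>

definition tr :: "nat \<Rightarrow> 'a sgrp \<Rightarrow> 'a sgrp" where
  "tr n X = \<lparr>lev = (\<lambda>k. if k \<le> n then lev X k else undefined),
             act = (\<lambda>j k. if j \<le> n \<and> k \<le> n then act X j k else undefined)\<rparr>"

text \<open>
  The \<open>n\<close>-coskeleton is the right Kan extension along the inclusion of the truncated simplex
  category: a \<open>k\<close>-simplex is a compatible family of elements of \<open>T\<^sub>j\<close>, indexed by all
  \<open>\<theta> : [j] \<rightarrow> [k]\<close> with \<open>j \<le> n\<close>. That it is right adjoint to \<open>tr n\<close> with unit \<open>cosk_unit\<close> is
  shown below.
\<close>

definition cosk_index :: "nat \<Rightarrow> nat \<Rightarrow> (nat \<times> (nat \<Rightarrow> nat)) set" where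
  "cosk_index n k = (SIGMA j:{..n}. Delta j k)"

definition cosk :: "nat \<Rightarrow> 'a sgrp \<Rightarrow> (nat \<times> (nat \<Rightarrow> nat) \<Rightarrow> 'a) sgrp" where
  "cosk n T =
     \<lparr>lev = (\<lambda>k. let P = product_group (cosk_index n k) (\<lambda>(j, \<theta>). lev T j) in
        P\<lparr>carrier := {x \<in> carrier P. \<forall>i\<le>n. \<forall>j\<le>n. \<forall>\<phi>\<in>Delta i j. \<forall>\<theta>\<in>Delta j k.
           act T i j \<phi> (x (j, \<theta>)) = x (i, compose {..i} \<theta> \<phi>)}\<rparr>),
      act = (\<lambda>j k \<phi> x. \<lambda>(i, \<theta>)\<in>cosk_index n j. x (i, compose {..i} \<phi> \<theta>))\<rparr>"

definition cosk_unit :: "nat \<Rightarrow> 'a sgrp \<Rightarrow> nat \<Rightarrow> 'a \<Rightarrow> (nat \<times> (nat \<Rightarrow> nat) \<Rightarrow> 'a)" where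
  "cosk_unit n X k x = (\<lambda>(j, \<theta>)\<in>cosk_index n k. act X j k \<theta> x)"

definition cosk_counit :: "nat \<Rightarrow> (nat \<times> (nat \<Rightarrow> nat) \<Rightarrow> 'a) \<Rightarrow> 'a" where
  "cosk_counit k x = x (k, Delta_id k)"


lemma simplicial_group_on_tr:
  assumes "simplicial_group X" shows "simplicial_group_on {..n} (tr n X)"
  unfolding simplicial_group_on_def tr_def
  using simplicial_group_onD[OF assms] by (simp del: One_nat_def)

lemma mem_cosk_index [simp]: "(j, \<theta>) \<in> cosk_index n k \<longleftrightarrow> j \<le> n \<and> \<theta> \<in> Delta j k"
  by (simp add: cosk_index_def)

lemma carrier_cosk:
  "x \<in> carrier (lev (cosk n T) k) \<longleftrightarrow>
     x \<in> extensional (cosk_index n k) \<and>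
     (\<forall>j\<le>n. \<forall>\<theta>\<in>Delta j k. x (j, \<theta>) \<in> carrier (lev T j)) \<and>
     (\<forall>i\<le>n. \<forall>j\<le>n. \<forall>\<phi>\<in>Delta i j. \<forall>\<theta>\<in>Delta j k.
        act T i j \<phi> (x (j, \<theta>)) = x (i, compose {..i} \<theta> \<phi>))"
  by (auto simp: cosk_def Let_def PiE_iff cosk_index_def)

lemma one_cosk: "\<one>\<^bsub>lev (cosk n T) k\<^esub> = (\<lambda>(j, \<theta>)\<in>cosk_index n k. \<one>\<^bsub>lev T j\<^esub>)"
  by (auto simp: cosk_def Let_def fun_eq_iff restrict_def)

lemma mult_cosk:
  "x \<otimes>\<^bsub>lev (cosk n T) k\<^esub> y = (\<lambda>(j, \<theta>)\<in>cosk_index n k. x (j, \<theta>) \<otimes>\<^bsub>lev T j\<^esub> y (j, \<theta>))"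
  by (auto simp: cosk_def Let_def fun_eq_iff restrict_def)

lemma act_cosk:
  "act (cosk n T) j k \<phi> x = (\<lambda>(i, \<theta>)\<in>cosk_index n j. x (i, compose {..i} \<phi> \<theta>))"
  by (simp add: cosk_def)

lemma cosk_eqI:
  assumes "x \<in> extensional (cosk_index n k)" "y \<in> extensional (cosk_index n k)"
    and "\<And>j \<theta>. j \<le> n \<Longrightarrow> \<theta> \<in> Delta j k \<Longrightarrow> x (j, \<theta>) = y (j, \<theta>)"
  shows "x = y"
  using assms by (intro extensionalityI[OF assms(1,2)]) auto

theorem simplicial_group_cosk:
  assumes T: "simplicial_group_on {..n} T"
  shows "simplicial_group (cosk n T)"
proof -
  let ?K = "cosk n T"
  have grpT: "group (lev T j)" if "j \<le> n" for j
    using simplicial_group_onD(1)[OF T] that by simp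
  have homT: "act T i j \<phi> \<in> hom (lev T j) (lev T i)" if "i \<le> n" "j \<le> n" "\<phi> \<in> Delta i j" for i j \<phi>
    using simplicial_group_onD(2)[OF T] that by simp
  have grp: "group (lev ?K k)" for k
  proof -
    let ?P = "product_group (cosk_index n k) (\<lambda>(j, \<theta>). lev T j)"
    let ?C = "carrier (lev ?K k)"
    have P: "group ?P" using grpT by (intro product_group) (auto simp: cosk_index_def)
    have eq: "lev ?K k = ?P\<lparr>carrier := ?C\<rparr>" by (simp add: cosk_def Let_def)
    have "subgroup ?C ?P"
    proof (rule group.subgroupI[OF P])
      show sub: "?C \<subseteq> carrier ?P" by (auto simp: cosk_def Let_def)
      have "\<one>\<^bsub>lev ?K k\<^esub> \<in> ?C"
        unfolding carrier_cosk one_cosk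
        using grpT homT hom_one[OF homT] by (simp add: Delta_compose group.is_monoid)
      then show "?C \<noteq> {}" by blast
      fix x assume x: "x \<in> ?C"
      have inv: "inv\<^bsub>?P\<^esub> x = (\<lambda>(j, \<theta>)\<in>cosk_index n k. inv\<^bsub>lev T j\<^esub> x (j, \<theta>))"
        using inv_product_group[of x "cosk_index n k" "\<lambda>(j, \<theta>). lev T j"] sub x grpT
        by (force simp: fun_eq_iff restrict_def cosk_index_def)
      have "act T i j \<phi> (inv\<^bsub>lev T j\<^esub> x (j, \<theta>)) = inv\<^bsub>lev T i\<^esub> x (i, compose {..i} \<theta> \<phi>)"
        if "i \<le> n" "j \<le> n" "\<phi> \<in> Delta i j" "\<theta> \<in> Delta j k" for i j \<phi> \<theta>
      proof -
        interpret group_hom "lev T j" "lev T i" "act T i j \<phi>"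
          using that grpT homT by (simp add: group_hom_def group_hom_axioms_def)
        show ?thesis using x that unfolding carrier_cosk by simp
      qed
      then show "inv\<^bsub>?P\<^esub> x \<in> ?C"
        unfolding carrier_cosk inv using x grpT
        by (simp add: carrier_cosk Delta_compose)
      fix y assume y: "y \<in> ?C"
      have "act T i j \<phi> (x (j, \<theta>) \<otimes>\<^bsub>lev T j\<^esub> y (j, \<theta>)) =
          x (i, compose {..i} \<theta> \<phi>) \<otimes>\<^bsub>lev T i\<^esub> y (i, compose {..i} \<theta> \<phi>)"
        if "i \<le> n" "j \<le> n" "\<phi> \<in> Delta i j" "\<theta> \<in> Delta j k" for i j \<phi> \<theta>
        using hom_mult[OF homT[OF that(1-3)]] x y that unfolding carrier_cosk by simp
      then have "x \<otimes>\<^bsub>lev ?K k\<^esub> y \<in> ?C"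
        unfolding carrier_cosk mult_cosk using x y grpT
        by (simp add: carrier_cosk Delta_compose group.is_monoid monoid.m_closed)
      moreover have "x \<otimes>\<^bsub>lev ?K k\<^esub> y = x \<otimes>\<^bsub>?P\<^esub> y" by (simp add: cosk_def Let_def)
      ultimately show "x \<otimes>\<^bsub>?P\<^esub> y \<in> ?C" by simp
    qed
    from subgroup.subgroup_is_group[OF this P] show ?thesis
      by (simp only: eq[symmetric])
  qed
  have closed: "act ?K j k \<phi> x \<in> carrier (lev ?K j)"
    if "\<phi> \<in> Delta j k" "x \<in> carrier (lev ?K k)" for j k \<phi> x
    using that unfolding carrier_cosk act_cosk
    by (simp add: Delta_compose Delta_compose_assoc)
  have hom: "act ?K j k \<phi> \<in> hom (lev ?K k) (lev ?K j)" if "\<phi> \<in> Delta j k" for j k \<phi>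
  proof (rule homI)
    fix x y assume "x \<in> carrier (lev ?K k)" "y \<in> carrier (lev ?K k)"
    show "act ?K j k \<phi> (x \<otimes>\<^bsub>lev ?K k\<^esub> y) = act ?K j k \<phi> x \<otimes>\<^bsub>lev ?K j\<^esub> act ?K j k \<phi> y"
      unfolding act_cosk mult_cosk
      by (rule cosk_eqI) (use that in \<open>auto simp: Delta_compose\<close>)
  qed (use closed that in blast)
  have id: "act ?K k k (Delta_id k) x = x" if "x \<in> carrier (lev ?K k)" for k x
    using that unfolding act_cosk
    by (intro cosk_eqI) (auto simp: carrier_cosk Delta_compose_id_left)
  have comp: "act ?K i k (compose {..i} \<theta> \<phi>) x = act ?K i j \<phi> (act ?K j k \<theta> x)"
    if "\<phi> \<in> Delta i j" "\<theta> \<in> Delta j k" for i j k \<phi> \<theta> x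
    unfolding act_cosk
    by (rule cosk_eqI) (use that in \<open>auto simp: Delta_compose Delta_compose_assoc\<close>)
  show ?thesis
    unfolding simplicial_group_on_def by (intro conjI ballI grp hom id comp)
qed

theorem shom_cosk_counit:
  assumes T: "simplicial_group_on {..n} T"
  shows "shom_on {..n} (tr n (cosk n T)) T cosk_counit"
  unfolding shom_on_def
proof (intro conjI ballI)
  fix k assume k: "k \<in> {..n}"
  then show "cosk_counit k \<in> hom (lev (tr n (cosk n T)) k) (lev T k)"
    by (intro homI) (auto simp: tr_def cosk_counit_def carrier_cosk mult_cosk)
next
  fix j k \<theta> x assume *: "j \<in> {..n}" "k \<in> {..n}" and t: "\<theta> \<in> Delta j k"
    and x: "x \<in> carrier (lev (tr n (cosk n T)) k)"
  then show "cosk_counit j (act (tr n (cosk n T)) j k \<theta> x) = act T j k \<theta> (cosk_counit k x)"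
    using Delta_compose_id_right[OF t] Delta_compose_id_left[OF t]
    by (simp add: tr_def cosk_counit_def carrier_cosk act_cosk)
qed

theorem cosk_universal:
  assumes T: "simplicial_group_on {..n} T" and Y: "simplicial_group Y"
    and f: "shom_on {..n} (tr n Y) T f"
  shows "\<exists>g. shom Y (cosk n T) g \<and> (\<forall>k\<le>n. \<forall>y\<in>carrier (lev Y k). cosk_counit k (g k y) = f k y)"
    and "\<lbrakk>shom Y (cosk n T) g; \<forall>k\<le>n. \<forall>y\<in>carrier (lev Y k). cosk_counit k (g k y) = f k y;
          shom Y (cosk n T) g'; \<forall>k\<le>n. \<forall>y\<in>carrier (lev Y k). cosk_counit k (g' k y) = f k y;
          y \<in> carrier (lev Y k)\<rbrakk> \<Longrightarrow> g k y = g' k y"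
proof -
  note homY = simplicial_group_onD(2)[OF Y, simplified]
  note closed = hom_in_carrier[OF homY]
  have fh: "f j \<in> hom (lev Y j) (lev T j)" if "j \<le> n" for j
    using shom_onD(1)[OF f, of j] that by (simp add: tr_def)
  have fn: "f i (act Y i j \<phi> y) = act T i j \<phi> (f j y)"
    if "i \<le> n" "j \<le> n" "\<phi> \<in> Delta i j" "y \<in> carrier (lev Y j)" for i j \<phi> y
    using shom_onD(2)[OF f, of i j \<phi> y] that by (simp add: tr_def)
  note compY = simplicial_group_onD(4)[OF Y, simplified]
  define g where "g = (\<lambda>k y. \<lambda>(j, \<theta>)\<in>cosk_index n k. f j (act Y j k \<theta> y))"
  have gc: "g k y \<in> carrier (lev (cosk n T) k)" if "y \<in> carrier (lev Y k)" for k y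
    unfolding carrier_cosk g_def
    using that hom_in_carrier[OF fh] closed by (simp add: Delta_compose compY fn)
  have "shom Y (cosk n T) g"
    unfolding shom_on_def
  proof (intro conjI ballI)
    fix k show "g k \<in> hom (lev Y k) (lev (cosk n T) k)"
    proof (rule homI)
      fix x y assume xy: "x \<in> carrier (lev Y k)" "y \<in> carrier (lev Y k)"
      show "g k (x \<otimes>\<^bsub>lev Y k\<^esub> y) = g k x \<otimes>\<^bsub>lev (cosk n T) k\<^esub> g k y"
        unfolding mult_cosk g_def
        by (rule cosk_eqI) (use xy in \<open>auto simp: hom_mult[OF homY] hom_mult[OF fh] closed\<close>)
    qed (rule gc)
  next
    fix j k \<theta> y assume *: "\<theta> \<in> Delta j k" "y \<in> carrier (lev Y k)"
    show "g j (act Y j k \<theta> y) = act (cosk n T) j k \<theta> (g k y)"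
      unfolding act_cosk g_def
      by (rule cosk_eqI) (use * in \<open>auto simp: Delta_compose compY\<close>)
  qed
  moreover have "\<forall>k\<le>n. \<forall>y\<in>carrier (lev Y k). cosk_counit k (g k y) = f k y"
    using simplicial_group_onD(3)[OF Y] by (simp add: cosk_counit_def g_def)
  ultimately show "\<exists>g. shom Y (cosk n T) g \<and>
      (\<forall>k\<le>n. \<forall>y\<in>carrier (lev Y k). cosk_counit k (g k y) = f k y)" by blast
  have val: "h k y (j, \<theta>) = f j (act Y j k \<theta> y)"
    if h: "shom Y (cosk n T) h" "\<forall>k\<le>n. \<forall>y\<in>carrier (lev Y k). cosk_counit k (h k y) = f k y"
      and y: "y \<in> carrier (lev Y k)" and j: "j \<le> n" and t: "\<theta> \<in> Delta j k" for h k y j \<theta>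
  proof -
    have "f j (act Y j k \<theta> y) = cosk_counit j (h j (act Y j k \<theta> y))"
      using h(2) j closed[OF t y] by simp
    also have "\<dots> = cosk_counit j (act (cosk n T) j k \<theta> (h k y))"
      using shom_onD(2)[OF h(1) _ _ t y] by simp
    also have "\<dots> = h k y (j, \<theta>)"
      using j Delta_compose_id_right[OF t] by (simp add: cosk_counit_def act_cosk)
    finally show ?thesis by simp
  qed
  show "g k y = g' k y"
    if g: "shom Y (cosk n T) g" "\<forall>k\<le>n. \<forall>y\<in>carrier (lev Y k). cosk_counit k (g k y) = f k y"
      and g': "shom Y (cosk n T) g'" "\<forall>k\<le>n. \<forall>y\<in>carrier (lev Y k). cosk_counit k (g' k y) = f k y"
      and y: "y \<in> carrier (lev Y k)" for g g' k y
  proof (rule cosk_eqI)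
    show "g k y \<in> extensional (cosk_index n k)" "g' k y \<in> extensional (cosk_index n k)"
      using hom_in_carrier[OF shom_onD(1)[OF g(1)] y] hom_in_carrier[OF shom_onD(1)[OF g'(1)] y]
      by (simp_all add: carrier_cosk)
  qed (simp add: val[OF g y] val[OF g' y])
qed

text \<open>\<open>cosk_unit\<close> is the unit: the morphism adjoint to the identity of \<open>tr n X\<close>.\<close>

theorem shom_cosk_unit:
  assumes X: "simplicial_group X"
  shows "shom X (cosk n (tr n X)) (cosk_unit n X)"
    and "\<lbrakk>k \<le> n; x \<in> carrier (lev X k)\<rbrakk> \<Longrightarrow> cosk_counit k (cosk_unit n X k x) = x"
proof -
  show unit: "cosk_counit k (cosk_unit n X k x) = x" if "k \<le> n" "x \<in> carrier (lev X k)" for k x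
    using that simplicial_group_onD(3)[OF X] by (simp add: cosk_counit_def cosk_unit_def)
  note homX = simplicial_group_onD(2)[OF X, simplified]
  note closed = hom_in_carrier[OF homX]
  note compX = simplicial_group_onD(4)[OF X, simplified]
  show "shom X (cosk n (tr n X)) (cosk_unit n X)"
    unfolding shom_on_def
  proof (intro conjI ballI)
    fix k show "cosk_unit n X k \<in> hom (lev X k) (lev (cosk n (tr n X)) k)"
    proof (rule homI)
      fix x assume "x \<in> carrier (lev X k)"
      then show "cosk_unit n X k x \<in> carrier (lev (cosk n (tr n X)) k)"
        unfolding carrier_cosk cosk_unit_def
        using closed by (simp add: tr_def Delta_compose compX)
    next
      fix x y assume "x \<in> carrier (lev X k)" "y \<in> carrier (lev X k)"
      then show "cosk_unit n X k (x \<otimes>\<^bsub>lev X k\<^esub> y) =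
          cosk_unit n X k x \<otimes>\<^bsub>lev (cosk n (tr n X)) k\<^esub> cosk_unit n X k y"
        unfolding mult_cosk cosk_unit_def
        by (intro cosk_eqI) (auto simp: tr_def hom_mult[OF homX])
    qed
  next
    fix j k \<theta> x assume "\<theta> \<in> Delta j k" "x \<in> carrier (lev X k)"
    then show "cosk_unit n X j (act X j k \<theta> x) = act (cosk n (tr n X)) j k \<theta> (cosk_unit n X k x)"
      unfolding act_cosk cosk_unit_def
      by (intro cosk_eqI) (auto simp: Delta_compose compX)
  qed
qed


section \<open>The radicals and the fundamental simplicial groups\<close>

text \<open>\<open>\<mu>\<^sub>n\<^sub>\<ge>(X)\<close>, the kernel of \<open>X \<rightarrow> Cot\<^sub>n(X)\<close>.\<close>

definition rad_cot :: "nat \<Rightarrow> 'a sgrp \<Rightarrow> nat \<Rightarrow> 'a set" where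
  "rad_cot n X = skernel X (Cot n X) (Cot_unit n X)"

text \<open>\<open>\<mu>\<^sub>\<ge>\<^sub>n(X)\<close>, the kernel of \<open>X \<rightarrow> cosk\<^sub>n\<^sub>-\<^sub>1 tr\<^sub>n\<^sub>-\<^sub>1(X)\<close>; meaningful only for \<open>n \<ge> 1\<close>.\<close>

definition rad_cosk :: "nat \<Rightarrow> 'a sgrp \<Rightarrow> nat \<Rightarrow> 'a set" where
  "rad_cosk n X = skernel X (cosk (n - 1) (tr (n - 1) X)) (cosk_unit (n - 1) X)"

lemma normal_simplicial_subgroup_rad:
  assumes X: "simplicial_group X"
  shows "normal_simplicial_subgroup X (rad_cot n X)"
    and "normal_simplicial_subgroup X (rad_cosk n X)"
proof -
  show "normal_simplicial_subgroup X (rad_cot n X)"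
    unfolding rad_cot_def using is_Cot_Cot[OF X, of n]
    by (intro normal_simplicial_subgroup_skernel[OF X]) (auto simp: is_Cot_def in_M_def)
  show "normal_simplicial_subgroup X (rad_cosk n X)"
    unfolding rad_cosk_def
    by (intro normal_simplicial_subgroup_skernel[OF X] simplicial_group_cosk
        simplicial_group_on_tr[OF X] shom_cosk_unit(1)[OF X])
qed

definition rad_quot :: "'a sgrp \<Rightarrow> (nat \<Rightarrow> 'a set) \<Rightarrow> (nat \<Rightarrow> 'a set) \<Rightarrow> 'a set sgrp" where
  "rad_quot X \<sigma> \<tau> = squot (ssub X \<sigma>) \<tau>"

text \<open>
  The upper index of \<open>\<Pi>\<close> gives the numerator (the identity if there is none), the lower index
  the denominator (trivial if there is none); \<open>cot\<close> stands for an index \<open>n\<ge>\<close> and \<open>cosk\<close> for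
  an index \<open>\<ge>n\<close>. For instance \<open>Pi_cot_cosk n m X\<close> is \<open>\<mu>\<^sub>n\<^sub>\<ge>(X) / \<mu>\<^sub>\<ge>\<^sub>m(X)\<close>.
\<close>

definition Pi_cosk_cot :: "nat \<Rightarrow> nat \<Rightarrow> 'a sgrp \<Rightarrow> 'a set sgrp" where
  "Pi_cosk_cot n m X = rad_quot X (rad_cosk n X) (rad_cot m X)"

definition Pi_cot_cosk :: "nat \<Rightarrow> nat \<Rightarrow> 'a sgrp \<Rightarrow> 'a set sgrp" where
  "Pi_cot_cosk n m X = rad_quot X (rad_cot n X) (rad_cosk m X)"

definition Pi_cosk_cosk :: "nat \<Rightarrow> nat \<Rightarrow> 'a sgrp \<Rightarrow> 'a set sgrp" where
  "Pi_cosk_cosk n m X = rad_quot X (rad_cosk n X) (rad_cosk m X)"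

definition Pi_cot_cot :: "nat \<Rightarrow> nat \<Rightarrow> 'a sgrp \<Rightarrow> 'a set sgrp" where
  "Pi_cot_cot n m X = rad_quot X (rad_cot n X) (rad_cot m X)"

definition Pi_upper_cosk :: "nat \<Rightarrow> 'a sgrp \<Rightarrow> 'a sgrp" where
  "Pi_upper_cosk n X = ssub X (rad_cosk n X)"

definition Pi_upper_cot :: "nat \<Rightarrow> 'a sgrp \<Rightarrow> 'a sgrp" where
  "Pi_upper_cot n X = ssub X (rad_cot n X)"

definition Pi_lower_cosk :: "nat \<Rightarrow> 'a sgrp \<Rightarrow> 'a set sgrp" where
  "Pi_lower_cosk n X = squot X (rad_cosk n X)"

definition Pi_lower_cot :: "nat \<Rightarrow> 'a sgrp \<Rightarrow> 'a set sgrp" where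
  "Pi_lower_cot n X = squot X (rad_cot n X)"

end

theory Submission
  imports Defs
begin

text \<open>
  For a normal simplicial subgroup \<open>T\<close> of \<open>X\<close>, the Moore complex of \<open>X / T\<close> is \<open>N(X) / N(T)\<close>, because an
  element of \<open>X\<^sub>k\<close> whose faces \<open>d\<^sub>0, \<dots>, d\<^sub>k\<^sub>-\<^sub>1\<close> lie in \<open>T\<close> can be moved into \<open>N(X)\<^sub>k\<close> by a factor from
  \<open>T\<^sub>k\<close>; for the same reason an inclusion of normal simplicial subgroups can be tested on Moore
  complexes. So everything reduces to the Moore complexes of the radicals. That of \<open>\<mu>\<^sub>\<ge>\<^sub>n\<^sub>+\<^sub>1\<close>
  is found directly, since a monotone map \<open>[j] \<rightarrow> [k]\<close> with \<open>j < k\<close> factors through a coface; that of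
  \<open>\<mu>\<^sub>n\<^sub>\<ge>\<close> follows from its minimality. Both radicals then agree, up to acyclic parts, with
  the truncation of \<open>N(X)\<close> above dimension \<open>n\<close>.
\<close>

text \<open>Face maps are stated with \<open>k - 1\<close>, which the simplifier should not turn into \<open>k - Suc 0\<close>.\<close>

declare One_nat_def [simp del]

lemma coface_mem [simp]: "k > 0 \<Longrightarrow> i \<le> k \<Longrightarrow> coface k i \<in> Delta (k - 1) k"
  using coface_in by (simp add: One_nat_def)

section \<open>Factoring simplicial operators through cofaces\<close>

text \<open>As the value \<open>i\<close> is never taken, lowering the larger values by one loses
  nothing, and \<open>coface k i\<close> restores them.\<close>

lemma Delta_factor_coface:
  assumes t: "\<theta> \<in> Delta j k" and i: "i \<le> k" "i \<notin> \<theta> ` {..j}"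
  obtains \<theta>' where "\<theta>' \<in> Delta j (k - 1)" "\<theta> = compose {..j} (coface k i) \<theta>'"
proof
  let ?t = "\<lambda>l\<in>{..j}. if \<theta> l < i then \<theta> l else \<theta> l - 1"
  have le: "\<theta> l \<le> k" if "l \<le> j" for l using Delta_mem[OF t that] .
  have ne: "\<theta> l \<noteq> i" if "l \<le> j" for l using i that by auto
  have mono: "\<theta> l \<le> \<theta> m" if "l \<le> m" "m \<le> j" for l m
    using t that by (auto simp: Delta_def mono_on_def)
  have bound: "(if \<theta> l < i then \<theta> l else \<theta> l - 1) \<le> k - 1" if "l \<le> j" for l
    using le[OF that] i(1) by auto
  show "?t \<in> Delta j (k - 1)"
    unfolding Delta_def
  proof (intro CollectI conjI mono_onI)
    show "?t \<in> {..j} \<rightarrow>\<^sub>E {..k - 1}" using bound by auto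
    fix l m assume lm: "l \<in> {..j}" "m \<in> {..j}" "l \<le> m"
    then show "?t l \<le> ?t m"
      using mono[of l m] by auto
  qed
  show "\<theta> = compose {..j} (coface k i) ?t"
  proof
    fix l
    show "\<theta> l = compose {..j} (coface k i) ?t l"
    proof (cases "l \<le> j")
      case True
      then have "compose {..j} (coface k i) ?t l
          = coface k i (if \<theta> l < i then \<theta> l else \<theta> l - 1)" by (simp add: compose_def)
      also have "\<dots> = \<theta> l"
        using bound[OF True] ne[OF True] i(1) by (cases "\<theta> l < i") (simp_all add: coface_def)
      finally show ?thesis by simp
    next
      case False
      then show ?thesis using t by (auto simp: compose_def Delta_def PiE_iff extensional_def)
    qed
  qed
qed

text \<open>Pigeonhole. The bound \<open>i \<le> m\<close> is kept because \<open>m\<close> may lie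
  below the top vertex of the target: with \<open>m = n + 1\<close> it finds a missed vertex among
  the first \<open>n + 2\<close>.\<close>

lemma ex_not_in_image:
  assumes "j < m"
  shows "\<exists>i\<le>m. i \<notin> (\<theta> :: nat \<Rightarrow> nat) ` {..j}"
proof (rule ccontr)
  assume "\<not> ?thesis"
  then have "{..m} \<subseteq> \<theta> ` {..j}" by blast
  then have "card {..m} \<le> card {..j}" by (meson finite_atMost surj_card_le)
  then show False using assms by simp
qed

text \<open>A surjection of \<open>[k]\<close> onto itself is injective; counting its values on
  \<open>{..l}\<close> and on \<open>{l..k}\<close> then forces \<open>\<theta> l \<ge> l\<close>
  and \<open>\<theta> l \<le> l\<close>.\<close>

lemma Delta_surj_id:
  assumes t: "\<theta> \<in> Delta k k" and surj: "\<forall>i\<le>k. i \<in> \<theta> ` {..k}"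
  shows "\<theta> = Delta_id k"
proof
  fix l
  have im: "\<theta> ` {..k} = {..k}" using surj Delta_mem[OF t] by auto
  then have inj: "inj_on \<theta> {..k}" by (simp add: eq_card_imp_inj_on)
  have mono: "\<theta> a \<le> \<theta> b" if "a \<le> b" "b \<le> k" for a b
    using t that by (auto simp: Delta_def mono_on_def)
  show "\<theta> l = Delta_id k l"
  proof (cases "l \<le> k")
    case True
    have "card (\<theta> ` {..l}) = Suc l" "card (\<theta> ` {l..k}) = Suc k - l"
      using True inj by (auto intro!: card_image[THEN trans] elim: inj_on_subset)
    moreover have "card (\<theta> ` {..l}) \<le> card {..\<theta> l}" "card (\<theta> ` {l..k}) \<le> card {\<theta> l..k}"
      using mono True Delta_mem[OF t] by (intro card_mono; force)+
    ultimately have "Suc l \<le> Suc (\<theta> l)" "Suc k - l \<le> Suc k - \<theta> l" by simp_all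
    then have "\<theta> l = l" using True by linarith
    then show ?thesis using True by (simp add: Delta_id_def)
  next
    case False
    then show ?thesis using t by (auto simp: Delta_id_def Delta_def PiE_iff extensional_def)
  qed
qed

section \<open>Moore complexes\<close>

locale sgroup =
  fixes X :: "'a sgrp"
  assumes sgroup: "simplicial_group X"
begin

sublocale G: group "lev X k" for k
  using simplicial_group_onD(1)[OF sgroup] by simp

lemma act_hom: "\<theta> \<in> Delta j k \<Longrightarrow> act X j k \<theta> \<in> hom (lev X k) (lev X j)"
  using simplicial_group_onD(2)[OF sgroup] by simp

lemma act_group_hom: "\<theta> \<in> Delta j k \<Longrightarrow> group_hom (lev X k) (lev X j) (act X j k \<theta>)"
  using act_hom by (simp add: group_hom_def group_hom_axioms_def)

lemma act_closed: "\<theta> \<in> Delta j k \<Longrightarrow> x \<in> carrier (lev X k) \<Longrightarrow> act X j k \<theta> x \<in> carrier (lev X j)"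
  using act_hom by (rule hom_in_carrier)

lemma act_comp:
  "\<phi> \<in> Delta i j \<Longrightarrow> \<theta> \<in> Delta j k \<Longrightarrow> x \<in> carrier (lev X k)
    \<Longrightarrow> act X i k (compose {..i} \<theta> \<phi>) x = act X i j \<phi> (act X j k \<theta> x)"
  using simplicial_group_onD(4)[OF sgroup] by simp

lemma act_id: "x \<in> carrier (lev X k) \<Longrightarrow> act X k k (Delta_id k) x = x"
  using simplicial_group_onD(3)[OF sgroup] by simp

lemma face_group_hom: "k > 0 \<Longrightarrow> i \<le> k \<Longrightarrow> group_hom (lev X k) (lev X (k - 1)) (face X k i)"
  unfolding face_def by (rule act_group_hom) simp

lemma face_closed: "k > 0 \<Longrightarrow> i \<le> k \<Longrightarrow> x \<in> carrier (lev X k) \<Longrightarrow> face X k i x \<in> carrier (lev X (k - 1))"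
  unfolding face_def by (rule act_closed) simp

lemma nss_sub: "normal_simplicial_subgroup X T \<Longrightarrow> subgroup (T k) (lev X k)"
  using normal_imp_subgroup normal_simplicial_subgroupD(1) by blast

lemma nss_trivial: "normal_simplicial_subgroup X (\<lambda>k. {\<one>\<^bsub>lev X k\<^esub>})"
  unfolding normal_simplicial_subgroup_def
  using G.one_is_normal group_hom.hom_one[OF act_group_hom] by auto

lemma nssI:
  "(\<And>k. T k \<lhd> lev X k) \<Longrightarrow> (\<And>j k \<theta> x. \<theta> \<in> Delta j k \<Longrightarrow> x \<in> T k \<Longrightarrow> act X j k \<theta> x \<in> T j)
    \<Longrightarrow> normal_simplicial_subgroup X T"
  unfolding normal_simplicial_subgroup_def by (auto simp: image_subset_iff)

lemma nss_Int:
  assumes "normal_simplicial_subgroup X S" "normal_simplicial_subgroup X T"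
  shows "normal_simplicial_subgroup X (\<lambda>k. S k \<inter> T k)"
proof (rule nssI)
  show "S k \<inter> T k \<lhd> lev X k" for k
    using G.normal_subgroup_intersect normal_simplicial_subgroupD(1) assms by blast
qed (use assms normal_simplicial_subgroupD(2) in auto)

lemma nss_face:
  "normal_simplicial_subgroup X T \<Longrightarrow> k > 0 \<Longrightarrow> i \<le> k \<Longrightarrow> x \<in> T k \<Longrightarrow> face X k i x \<in> T (k - 1)"
  unfolding face_def by (rule normal_simplicial_subgroupD(2)) auto

text \<open>Such an operator acts through the face \<open>d_i\<close>, so only that face of
  \<open>x\<close> matters. Applied to composites of operators, this stands in for most simplicial
  identities.\<close>

lemma act_mem_if_misses:
  assumes T: "normal_simplicial_subgroup X T" and t: "\<theta> \<in> Delta j k" and x: "x \<in> carrier (lev X k)"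
    and i: "i \<le> k" "i \<notin> \<theta> ` {..j}" and f: "face X k i x \<in> T (k - 1)"
  shows "act X j k \<theta> x \<in> T j"
proof -
  obtain \<theta>' where t': "\<theta>' \<in> Delta j (k - 1)" "\<theta> = compose {..j} (coface k i) \<theta>'"
    using Delta_factor_coface[OF t i] .
  \<comment> \<open>\<open>k = 0\<close> would force \<open>i = 0\<close>, which is then the only
    possible value of \<open>\<theta>\<close> and so is not missed.\<close>
  have k: "k > 0"
    using i Delta_mem[OF t, of 0] by (cases k) auto
  have "act X j k \<theta> x = act X j (k - 1) \<theta>' (face X k i x)"
    unfolding t'(2) face_def by (rule act_comp[OF t'(1) _ x]) (use k i in simp)
  then show ?thesis using normal_simplicial_subgroupD(2)[OF T t'(1) f] by simp
qed

lemma act_one_if_misses: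
  assumes "\<theta> \<in> Delta j k" "x \<in> carrier (lev X k)" "i \<le> k" "i \<notin> \<theta> ` {..j}"
    and "face X k i x = \<one>\<^bsub>lev X (k - 1)\<^esub>"
  shows "act X j k \<theta> x = \<one>\<^bsub>lev X j\<^esub>"
  using act_mem_if_misses[OF nss_trivial assms(1-4)] assms(5) by simp

lemma mem_moore:
  "x \<in> carrier (moore X k) \<longleftrightarrow> x \<in> carrier (lev X k) \<and> (\<forall>i<k. face X k i x = \<one>\<^bsub>lev X (k - 1)\<^esub>)"
  by (simp add: moore_def)

lemma subgroup_moore: "subgroup (carrier (moore X k)) (lev X k)"
proof (cases "k = 0")
  case True
  have "carrier (moore X k) = carrier (lev X k)" using True by (auto simp: mem_moore)
  then show ?thesis by (simp add: G.subgroup_self)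
next
  case False
  have f: "group_hom (lev X k) (lev X (k - 1)) (face X k i)" if "i < k" for i
    using that by (intro face_group_hom) auto
  have "\<one>\<^bsub>lev X k\<^esub> \<in> carrier (moore X k)"
    using group_hom.hom_one[OF f] by (simp add: mem_moore)
  then have "carrier (moore X k) \<noteq> {}" by blast
  then show ?thesis
    by (intro G.subgroupI) (auto simp: mem_moore group_hom.hom_mult[OF f] group_hom.hom_inv[OF f])
qed

lemma normal_moore: "carrier (moore X k) \<lhd> lev X k"
proof (rule G.normal_invI[OF subgroup_moore])
  fix x h assume x: "x \<in> carrier (lev X k)" and h: "h \<in> carrier (moore X k)"
  have "face X k i (x \<otimes>\<^bsub>lev X k\<^esub> h \<otimes>\<^bsub>lev X k\<^esub> inv\<^bsub>lev X k\<^esub> x) = \<one>\<^bsub>lev X (k - 1)\<^esub>" if "i < k" for i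
  proof -
    interpret f: group_hom "lev X k" "lev X (k - 1)" "face X k i"
      using that by (intro face_group_hom) auto
    show ?thesis using x h that by (simp add: mem_moore)
  qed
  then show "x \<otimes>\<^bsub>lev X k\<^esub> h \<otimes>\<^bsub>lev X k\<^esub> inv\<^bsub>lev X k\<^esub> x \<in> carrier (moore X k)"
    using x h by (simp add: mem_moore)
qed

section \<open>Cycles and boundaries of the Moore complex\<close>

lemma mem_moore_cycles:
  "x \<in> moore_cycles X k \<longleftrightarrow>
     x \<in> carrier (moore X k) \<and> (k > 0 \<longrightarrow> face X k k x = \<one>\<^bsub>lev X (k - 1)\<^esub>)"
proof (cases "k = 0")
  case True
  then show ?thesis by (simp add: moore_cycles_def)
next
  case False
  then show ?thesis by (simp add: moore_cycles_def kernel_def moore_diff_def) (simp add: moore_def)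
qed

lemma mem_moore_boundaries:
  "y \<in> moore_boundaries X k \<longleftrightarrow> (\<exists>x\<in>carrier (moore X (Suc k)). y = face X (Suc k) (Suc k) x)"
  by (auto simp: moore_boundaries_def moore_diff_def)

text \<open>Contains both that \<delta> preserves the Moore complex and that \<delta>\<delta> is
  trivial: for every \<open>i < k\<close> the operator inducing \<open>d_i d_k\<close> misses the
  vertex \<open>i\<close>, and \<open>d_i x\<close> is trivial.\<close>

lemma last_face_moore:
  assumes k: "k > 0" and x: "x \<in> carrier (moore X k)"
  shows "face X k k x \<in> moore_cycles X (k - 1)"
proof -
  have xc: "x \<in> carrier (lev X k)" using x by (simp add: mem_moore)
  have "face X (k - 1) i (face X k k x) = \<one>\<^bsub>lev X (k - 1 - 1)\<^esub>" if i: "i \<le> k - 1" "k - 1 > 0" for i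
  proof -
    have c: "coface (k - 1) i \<in> Delta (k - 1 - 1) (k - 1)" "coface k k \<in> Delta (k - 1) k"
      using coface_mem[OF i(2,1)] coface_mem[OF k, of k] by simp_all
    have "face X (k - 1) i (face X k k x)
        = act X (k - 1 - 1) k (compose {..k - 1 - 1} (coface k k) (coface (k - 1) i)) x"
      unfolding face_def by (rule act_comp[OF c xc, symmetric])
    also have "\<dots> = \<one>\<^bsub>lev X (k - 1 - 1)\<^esub>"
    proof (rule act_one_if_misses[where i = i, OF Delta_compose[OF c] xc])
      have "i < k" using i k by linarith
      then show "i \<le> k" "face X k i x = \<one>\<^bsub>lev X (k - 1)\<^esub>" using x by (simp_all add: mem_moore)
      \<comment> \<open>The inner coface already skips \<open>i\<close> and takes values below
        \<open>k\<close>, where \<open>coface k k\<close> changes nothing.\<close>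
      have "coface k k (coface (k - 1) i l) \<noteq> i" if "l \<in> {..k - 1 - 1}" for l
      proof -
        have "coface (k - 1) i l = (if l < i then l else l + 1)" using that by (simp add: coface_def)
        then have "coface (k - 1) i l \<noteq> i" "coface (k - 1) i l < k" using that i by auto
        then show ?thesis unfolding coface_def[of k] restrict_def by auto
      qed
      then show "i \<notin> compose {..k - 1 - 1} (coface k k) (coface (k - 1) i) ` {..k - 1 - 1}"
        unfolding image_iff using compose_eq by metis
    qed
    finally show ?thesis .
  qed
  note faces = this
  show ?thesis
    unfolding mem_moore_cycles mem_moore
  proof (intro conjI allI impI)
    show "face X k k x \<in> carrier (lev X (k - 1))"
      by (rule face_closed[OF k order.refl xc])
  next
    fix i assume "i < k - 1"
    then show "face X (k - 1) i (face X k k x) = \<one>\<^bsub>lev X (k - 1 - 1)\<^esub>"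
      by (intro faces) auto
  next
    assume "k - 1 > 0"
    then show "face X (k - 1) (k - 1) (face X k k x) = \<one>\<^bsub>lev X (k - 1 - 1)\<^esub>"
      by (intro faces) auto
  qed
qed

lemma moore_boundaries_cycles: "moore_boundaries X k \<subseteq> moore_cycles X k"
proof
  fix y assume "y \<in> moore_boundaries X k"
  then obtain x where "x \<in> carrier (moore X (Suc k))" "y = face X (Suc k) (Suc k) x"
    unfolding mem_moore_boundaries by blast
  then show "y \<in> moore_cycles X k"
    using last_face_moore[of "Suc k" x] by simp
qed

lemma subgroup_cycles: "subgroup (moore_cycles X k) (lev X k)"
proof (cases "k = 0")
  case True
  then show ?thesis using subgroup_moore[of k] by (simp add: moore_cycles_def)
next
  case False
  interpret f: group_hom "lev X k" "lev X (k - 1)" "face X k k"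
    using False by (intro face_group_hom) auto
  have "moore_cycles X k = carrier (moore X k) \<inter> kernel (lev X k) (lev X (k - 1)) (face X k k)"
    using False by (auto simp: mem_moore_cycles mem_moore kernel_def)
  then show ?thesis
    using G.subgroups_Inter_pair[OF subgroup_moore f.subgroup_kernel] by simp
qed

text \<open>The witness is the last degeneracy of \<open>x\<close>, induced by repeating the vertex
  \<open>k\<close>. It allows conjugation in dimension \<open>k\<close> to be lifted to dimension
  \<open>k + 1\<close>.\<close>

lemma degenerate_lift:
  assumes x: "x \<in> carrier (lev X k)"
  obtains y where "y \<in> carrier (lev X (Suc k))" "face X (Suc k) (Suc k) y = x"
proof
  let ?s = "\<lambda>l\<in>{..Suc k}. min l k"
  have s: "?s \<in> Delta (Suc k) k" by (auto simp: Delta_def mono_on_def)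
  show "act X (Suc k) k ?s x \<in> carrier (lev X (Suc k))" by (rule act_closed[OF s x])
  have c: "coface (Suc k) (Suc k) \<in> Delta k (Suc k)" using coface_mem[of "Suc k" "Suc k"] by simp
  have "compose {..k} ?s (coface (Suc k) (Suc k)) = Delta_id k"
    by (auto simp: compose_def coface_def Delta_id_def)
  then show "face X (Suc k) (Suc k) (act X (Suc k) k ?s x) = x"
    using act_comp[OF c s x] act_id[OF x] by (simp add: face_def)
qed

text \<open>Conjugation by \<open>x\<close> lifts along the last face to conjugation by a preimage
  of \<open>x\<close>, which preserves the Moore complex. Normality in all of
  \<open>lev X k\<close>, not just among the cycles, is what makes \<open>cot_bound\<close> normal
  later.\<close>

lemma normal_boundaries: "moore_boundaries X k \<lhd> lev X k"
proof -
  interpret f: group_hom "lev X (Suc k)" "lev X k" "face X (Suc k) (Suc k)"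
    using face_group_hom[of "Suc k" "Suc k"] by simp
  show ?thesis
  proof (rule G.normal_invI)
    show "subgroup (moore_boundaries X k) (lev X k)"
      unfolding moore_boundaries_def moore_diff_def
      by (rule f.subgroup_img_is_subgroup[OF subgroup_moore])
    fix x h assume x: "x \<in> carrier (lev X k)" and h: "h \<in> moore_boundaries X k"
    obtain y where y: "y \<in> carrier (lev X (Suc k))" "face X (Suc k) (Suc k) y = x"
      using degenerate_lift[OF x] .
    obtain z where z: "z \<in> carrier (moore X (Suc k))" "h = face X (Suc k) (Suc k) z"
      using h by (auto simp: mem_moore_boundaries)
    have zc: "z \<in> carrier (lev X (Suc k))" using z by (simp add: mem_moore)
    have "y \<otimes>\<^bsub>lev X (Suc k)\<^esub> z \<otimes>\<^bsub>lev X (Suc k)\<^esub> inv\<^bsub>lev X (Suc k)\<^esub> y \<in> carrier (moore X (Suc k))"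
      using normal.inv_op_closed2[OF normal_moore y(1) z(1)] .
    then show "x \<otimes>\<^bsub>lev X k\<^esub> h \<otimes>\<^bsub>lev X k\<^esub> inv\<^bsub>lev X k\<^esub> x \<in> moore_boundaries X k"
      using y zc z(2) by (force simp: mem_moore_boundaries)
  qed
qed

section \<open>Moving elements into the Moore complex\<close>

text \<open>
  The faces \<open>d\<^sub>0, \<dots>, d\<^sub>k\<^sub>-\<^sub>1\<close> of \<open>x\<close> are made trivial one after the other, dividing by \<open>s\<^sub>i d\<^sub>i x\<close>
  in step \<open>i\<close>; this does not disturb the earlier faces.
\<close>

lemma moore_lift:
  assumes T: "normal_simplicial_subgroup X T" and x: "x \<in> carrier (lev X k)"
    and d: "\<And>i. i < k \<Longrightarrow> face X k i x \<in> T (k - 1)"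
  obtains t where "t \<in> T k" "x \<otimes>\<^bsub>lev X k\<^esub> t \<in> carrier (moore X k)"
proof -
  have "\<exists>t\<in>T k. \<forall>l<i. face X k l (x \<otimes>\<^bsub>lev X k\<^esub> t) = \<one>\<^bsub>lev X (k - 1)\<^esub>" if "i \<le> k" for i
    using that
  proof (induction i)
    case 0
    then show ?case using subgroup.one_closed[OF nss_sub[OF T]] by auto
  next
    case (Suc i)
    then have i: "i < k" and k: "k > 0" by auto
    have f: "group_hom (lev X k) (lev X (k - 1)) (face X k l)" if "l \<le> k" for l
      using that k by (intro face_group_hom) auto
    obtain t where t: "t \<in> T k" "\<And>l. l < i \<Longrightarrow> face X k l (x \<otimes>\<^bsub>lev X k\<^esub> t) = \<one>\<^bsub>lev X (k - 1)\<^esub>"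
      using Suc by auto
    have tc: "t \<in> carrier (lev X k)" using subgroup.mem_carrier[OF nss_sub[OF T] t(1)] .
    define z where "z = x \<otimes>\<^bsub>lev X k\<^esub> t"
    have zc: "z \<in> carrier (lev X k)" using x tc by (simp add: z_def)
    \<comment> \<open>The operator inducing \<open>s_i d_i\<close>, written as a single map of
      \<open>[k]\<close> that misses \<open>i\<close>; hence \<open>w\<close> is
      \<open>s_i d_i z\<close>.\<close>
    let ?e = "\<lambda>m\<in>{..k}. if m = i then Suc i else m"
    define w where "w = act X k k ?e z"
    have e: "?e \<in> Delta k k" using i by (auto simp: Delta_def mono_on_def)
    have wc: "w \<in> carrier (lev X k)" unfolding w_def by (rule act_closed[OF e zc])
    have c: "coface k l \<in> Delta (k - 1) k" if "l \<le> k" for l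
      using coface_mem[OF k that] by simp
    have "face X k i z \<in> T (k - 1)"
      unfolding z_def using i x tc d[OF i] nss_face[OF T k _ t(1)] subgroup.m_closed[OF nss_sub[OF T]]
      by (simp add: group_hom.hom_mult[OF f])
    then have wT: "w \<in> T k"
      unfolding w_def using i by (intro act_mem_if_misses[OF T e zc, where i = i]) auto
    have fw: "face X k l w = act X (k - 1) k (compose {..k - 1} ?e (coface k l)) z" if "l \<le> k" for l
      unfolding w_def face_def by (rule act_comp[OF c[OF that] e zc, symmetric])
    \<comment> \<open>\<open>coface k i\<close> never takes the value \<open>i\<close>, the only
      point moved by \<open>?e\<close>; so \<open>z\<close> and \<open>w\<close> have the same
      \<open>i\<close>-th face.\<close>
    have "compose {..k - 1} ?e (coface k i) = coface k i"
      using k i by (auto simp: compose_def coface_def fun_eq_iff)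
    then have wi: "face X k i w = face X k i z" using fw[of i] i by (simp add: face_def)
    \<comment> \<open>For \<open>l < i\<close> the composite operator still misses \<open>l\<close>,
      and the \<open>l\<close>-th face of \<open>z\<close> is already trivial.\<close>
    have wl: "face X k l w = \<one>\<^bsub>lev X (k - 1)\<^esub>" if l: "l < i" for l
      unfolding fw[OF order.trans[OF less_imp_le[OF l] less_imp_le[OF i]]]
      using l i k t(2)[OF l] Delta_compose[OF c e]
      by (intro act_one_if_misses[OF _ zc, where i = l]) (auto simp: compose_def coface_def z_def)
    show ?case
    proof (intro bexI[of _ "t \<otimes>\<^bsub>lev X k\<^esub> inv\<^bsub>lev X k\<^esub> w"] allI impI)
      show "t \<otimes>\<^bsub>lev X k\<^esub> inv\<^bsub>lev X k\<^esub> w \<in> T k"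
        using t(1) wT subgroup.m_closed[OF nss_sub[OF T]] subgroup.m_inv_closed[OF nss_sub[OF T]] by blast
      fix l assume l: "l < Suc i"
      have eq: "x \<otimes>\<^bsub>lev X k\<^esub> (t \<otimes>\<^bsub>lev X k\<^esub> inv\<^bsub>lev X k\<^esub> w) = z \<otimes>\<^bsub>lev X k\<^esub> inv\<^bsub>lev X k\<^esub> w"
        unfolding z_def using x tc wc by (simp add: G.m_assoc)
      have "face X k l z = face X k l w"
        using l wi wl t(2) by (cases "l = i") (auto simp: z_def)
      then show "face X k l (x \<otimes>\<^bsub>lev X k\<^esub> (t \<otimes>\<^bsub>lev X k\<^esub> inv\<^bsub>lev X k\<^esub> w)) = \<one>\<^bsub>lev X (k - 1)\<^esub>"
        unfolding eq using l i zc wc face_closed[OF k _ wc, of l]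
        by (simp add: group_hom.hom_mult[OF f] group_hom.hom_inv[OF f])
    qed
  qed
  from this[of k] obtain t where "t \<in> T k" "\<forall>l<k. face X k l (x \<otimes>\<^bsub>lev X k\<^esub> t) = \<one>\<^bsub>lev X (k - 1)\<^esub>"
    by blast
  then show thesis
    using that x subgroup.mem_carrier[OF nss_sub[OF T]] by (simp add: mem_moore)
qed

text \<open>Induction on the dimension: the faces of an element of \<open>T\<close> lie in
  \<open>S\<close> as well, so a factor from \<open>T \<inter> S\<close> moves it into the Moore
  complex. The product stays in \<open>T\<close>, hence lies in \<open>S\<close> by assumption, and
  the factor is cancelled inside \<open>S\<close>.\<close>

lemma nss_subset_if_moore_subset:
  assumes S: "normal_simplicial_subgroup X S" and T: "normal_simplicial_subgroup X T"
    and le: "\<And>k. T k \<inter> carrier (moore X k) \<subseteq> S k"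
  shows "T k \<subseteq> S k"
proof (induction k)
  case 0
  have "T 0 \<subseteq> carrier (moore X 0)"
    using subgroup.mem_carrier[OF nss_sub[OF T]] by (auto simp: mem_moore)
  then show ?case using le[of 0] by blast
next
  case (Suc k)
  show ?case
  proof
    fix x assume x: "x \<in> T (Suc k)"
    have xc: "x \<in> carrier (lev X (Suc k))" using subgroup.mem_carrier[OF nss_sub[OF T] x] .
    obtain t where t: "t \<in> T (Suc k) \<inter> S (Suc k)"
        "x \<otimes>\<^bsub>lev X (Suc k)\<^esub> t \<in> carrier (moore X (Suc k))"
      using nss_face[OF T _ _ x] Suc
      by (elim moore_lift[OF nss_Int[OF T S] xc, rotated]) force+
    have tc: "t \<in> carrier (lev X (Suc k))" using subgroup.mem_carrier[OF nss_sub[OF T]] t by blast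
    have "x \<otimes>\<^bsub>lev X (Suc k)\<^esub> t \<in> S (Suc k)"
      using le[of "Suc k"] t subgroup.m_closed[OF nss_sub[OF T] x] by blast
    moreover have "inv\<^bsub>lev X (Suc k)\<^esub> t \<in> S (Suc k)"
      using t subgroup.m_inv_closed[OF nss_sub[OF S]] by blast
    ultimately have "x \<otimes>\<^bsub>lev X (Suc k)\<^esub> t \<otimes>\<^bsub>lev X (Suc k)\<^esub> inv\<^bsub>lev X (Suc k)\<^esub> t \<in> S (Suc k)"
      by (rule subgroup.m_closed[OF nss_sub[OF S]])
    then show "x \<in> S (Suc k)" using xc tc by (simp add: G.m_assoc)
  qed
qed

end

section \<open>Homotopy groups of subgroups and quotients\<close>

lemma lev_ssub: "lev (ssub X T) k = (lev X k)\<lparr>carrier := T k\<rparr>"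
  by (simp add: ssub_def)

lemma act_ssub: "act (ssub X T) = act X"
  by (simp add: ssub_def)

lemma face_ssub: "face (ssub X T) = face X"
  by (simp add: face_def act_ssub fun_eq_iff)

text \<open>
  \<open>cuts n X T\<close> says that \<open>N(T)\<close> is acyclic up to dimension \<open>n\<close>, and that \<open>N(T) \<rightarrow> N(X)\<close> is an
  isomorphism on homology above \<open>n\<close>. Both \<open>\<mu>\<^sub>n\<^sub>\<ge>\<close> and \<open>\<mu>\<^sub>\<ge>\<^sub>n\<^sub>+\<^sub>1\<close> have this property: \<open>N(\<mu>\<^sub>n\<^sub>\<ge>)\<close> is
  \<open>\<delta>(N(X)\<^sub>n\<^sub>+\<^sub>1)\<close> in dimension \<open>n\<close> and \<open>N(X)\<close> above, and \<open>N(\<mu>\<^sub>\<ge>\<^sub>n\<^sub>+\<^sub>1)\<close> is \<open>ker \<delta>\<^sub>n\<^sub>+\<^sub>1\<close> in dimension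
  \<open>n + 1\<close> and \<open>N(X)\<close> above.
\<close>

definition cuts :: "nat \<Rightarrow> 'a sgrp \<Rightarrow> (nat \<Rightarrow> 'a set) \<Rightarrow> bool" where
  "cuts n X T \<longleftrightarrow> normal_simplicial_subgroup X T \<and>
     (\<forall>k<n. T k \<inter> carrier (moore X k) \<subseteq> {\<one>\<^bsub>lev X k\<^esub>}) \<and>
     T n \<inter> carrier (moore X n) \<subseteq> face X (Suc n) (Suc n) ` (T (Suc n) \<inter> carrier (moore X (Suc n))) \<and>
     (\<forall>x\<in>carrier (moore X (Suc n)). face X (Suc n) (Suc n) x \<in> T n \<longrightarrow> x \<in> T (Suc n)) \<and>
     (\<forall>k>Suc n. carrier (moore X k) \<subseteq> T k)"

lemma cutsD:
  assumes "cuts n X T"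
  shows "normal_simplicial_subgroup X T"
    and "\<And>k x. \<lbrakk>k < n; x \<in> T k; x \<in> carrier (moore X k)\<rbrakk> \<Longrightarrow> x = \<one>\<^bsub>lev X k\<^esub>"
    and "T n \<inter> carrier (moore X n) \<subseteq> face X (Suc n) (Suc n) ` (T (Suc n) \<inter> carrier (moore X (Suc n)))"
    and "\<And>x. \<lbrakk>x \<in> carrier (moore X (Suc n)); face X (Suc n) (Suc n) x \<in> T n\<rbrakk> \<Longrightarrow> x \<in> T (Suc n)"
    and "\<And>k x. \<lbrakk>k > Suc n; x \<in> carrier (moore X k)\<rbrakk> \<Longrightarrow> x \<in> T k"
  using assms unfolding cuts_def by blast+

context sgroup
begin

lemma normal_boundaries_in_cycles:
  "moore_boundaries X i \<lhd> (lev X i)\<lparr>carrier := moore_cycles X i\<rparr>"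
  by (rule G.normal_restrict_supergroup[OF subgroup_cycles normal_boundaries moore_boundaries_cycles])

lemma group_homotopy_group: "group (homotopy_group i X)"
  unfolding homotopy_group_def by (rule normal.factorgroup_is_group[OF normal_boundaries_in_cycles])

lemma trivial_homotopy_group:
  assumes "moore_cycles X i \<subseteq> moore_boundaries X i"
  shows "trivial_group (homotopy_group i X)"
proof -
  let ?C = "(lev X i)\<lparr>carrier := moore_cycles X i\<rparr>"
  interpret B: normal "moore_boundaries X i" ?C by (rule normal_boundaries_in_cycles)
  have "moore_boundaries X i #>\<^bsub>?C\<^esub> x = moore_boundaries X i" if "x \<in> carrier ?C" for x
    using that assms by (intro B.coset_join2[OF that B.subgroup_axioms]) auto
  then show ?thesis
    unfolding group.trivial_group_subset[OF group_homotopy_group]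
    by (auto simp: homotopy_group_def FactGroup_def RCOSETS_def)
qed

section \<open>Homotopy groups of normal simplicial subgroups\<close>

lemma sgroup_ssub:
  assumes T: "normal_simplicial_subgroup X T"
  shows "sgroup (ssub X T)"
proof
  have grp: "group (lev (ssub X T) k)" for k
    unfolding lev_ssub using G.subgroup_imp_group[OF nss_sub[OF T]] .
  have hom: "act (ssub X T) j k \<theta> \<in> hom (lev (ssub X T) k) (lev (ssub X T) j)"
    if t: "\<theta> \<in> Delta j k" for j k \<theta>
    using hom_mult[OF act_hom[OF t]] normal_simplicial_subgroupD(2)[OF T t]
      subgroup.mem_carrier[OF nss_sub[OF T]]
    by (intro homI) (auto simp: lev_ssub act_ssub)
  have id: "act (ssub X T) k k (Delta_id k) x = x" if "x \<in> carrier (lev (ssub X T) k)" for k x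
    using that act_id subgroup.mem_carrier[OF nss_sub[OF T]] by (simp add: lev_ssub act_ssub)
  have comp: "act (ssub X T) i k (compose {..i} \<theta> \<phi>) x = act (ssub X T) i j \<phi> (act (ssub X T) j k \<theta> x)"
    if "\<phi> \<in> Delta i j" "\<theta> \<in> Delta j k" "x \<in> carrier (lev (ssub X T) k)" for i j k \<phi> \<theta> x
    using that act_comp subgroup.mem_carrier[OF nss_sub[OF T]] by (simp add: lev_ssub act_ssub)
  show "simplicial_group (ssub X T)"
    unfolding simplicial_group_on_def by (intro conjI ballI grp hom id comp)
qed

lemma carrier_moore_ssub:
  assumes T: "normal_simplicial_subgroup X T"
  shows "carrier (moore (ssub X T) k) = T k \<inter> carrier (moore X k)"
  using subgroup.subset[OF nss_sub[OF T, of k]] by (auto simp: moore_def lev_ssub face_ssub)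

lemma moore_cycles_ssub:
  assumes T: "normal_simplicial_subgroup X T"
  shows "moore_cycles (ssub X T) k = T k \<inter> moore_cycles X k"
proof -
  interpret S: sgroup "ssub X T" by (rule sgroup_ssub[OF T])
  show ?thesis
    by (auto simp: S.mem_moore_cycles mem_moore_cycles face_ssub lev_ssub carrier_moore_ssub[OF T])
qed

lemma moore_boundaries_ssub:
  assumes T: "normal_simplicial_subgroup X T"
  shows "moore_boundaries (ssub X T) k
    = face X (Suc k) (Suc k) ` (T (Suc k) \<inter> carrier (moore X (Suc k)))"
  using carrier_moore_ssub[OF T]
  by (simp add: moore_boundaries_def moore_diff_def face_ssub)

text \<open>The last face of a cycle is trivial, hence in \<open>T\<close>, so the preimage
  condition of \<open>cuts\<close> covers dimension \<open>n + 1\<close>; above that,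
  \<open>T\<close> contains the whole Moore complex.\<close>

lemma cuts_cycles_subset:
  assumes c: "cuts n X T" and i: "i > n"
  shows "moore_cycles X i \<subseteq> T i"
proof
  fix x assume x: "x \<in> moore_cycles X i"
  have "face X i i x \<in> T (i - 1)"
    using x i subgroup.one_closed[OF nss_sub[OF cutsD(1)[OF c]]] by (simp add: mem_moore_cycles)
  then show "x \<in> T i"
    using x i cutsD(4,5)[OF c] by (cases "i = Suc n") (auto simp: mem_moore_cycles)
qed

text \<open>Cycles and boundaries are literally those of \<open>X\<close>, which gives an equality
  of structures and not only an isomorphism.\<close>

lemma homotopy_group_ssub_above:
  assumes c: "cuts n X T" and i: "i > n"
  shows "homotopy_group i (ssub X T) = homotopy_group i X"
proof -
  note T = cutsD(1)[OF c]
  have "moore_cycles (ssub X T) i = moore_cycles X i"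
    using moore_cycles_ssub[OF T] cuts_cycles_subset[OF c i] by blast
  moreover have "T (Suc i) \<inter> carrier (moore X (Suc i)) = carrier (moore X (Suc i))"
    using cutsD(5)[OF c] i by auto
  then have "moore_boundaries (ssub X T) i = moore_boundaries X i"
    unfolding moore_boundaries_ssub[OF T] by (simp add: moore_boundaries_def moore_diff_def)
  ultimately show ?thesis by (simp add: homotopy_group_def lev_ssub)
qed

text \<open>In dimension \<open>n\<close> each Moore element of \<open>T\<close> bounds inside
  \<open>T\<close>; below it only the identity is left.\<close>

lemma homotopy_group_ssub_below:
  assumes c: "cuts n X T" and i: "i \<le> n"
  shows "trivial_group (homotopy_group i (ssub X T))"
proof -
  note T = cutsD(1)[OF c]
  interpret S: sgroup "ssub X T" by (rule sgroup_ssub[OF T])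
  show ?thesis
  proof (rule S.trivial_homotopy_group)
    have cyc: "moore_cycles (ssub X T) i \<subseteq> T i \<inter> carrier (moore X i)"
      using moore_cycles_ssub[OF T] mem_moore_cycles by auto
    show "moore_cycles (ssub X T) i \<subseteq> moore_boundaries (ssub X T) i"
    proof (cases "i = n")
      case True
      then show ?thesis using cyc cutsD(3)[OF c] moore_boundaries_ssub[OF T] by blast
    next
      case False
      then have "moore_cycles (ssub X T) i \<subseteq> {\<one>\<^bsub>lev (ssub X T) i\<^esub>}"
        using cyc cutsD(2)[OF c, of i] i by (auto simp: lev_ssub)
      then show ?thesis
        using subgroup.one_closed[OF normal_imp_subgroup[OF S.normal_boundaries[of i]]] by blast
    qed
  qed
qed

section \<open>Homotopy groups of quotients\<close>

lemma sgroup_squot: "normal_simplicial_subgroup X T \<Longrightarrow> sgroup (squot X T)"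
  using simplicial_group_squot[OF sgroup] by (simp add: sgroup_def)

lemma proj_group_hom:
  assumes T: "normal_simplicial_subgroup X T"
  shows "group_hom (lev X k) (lev (squot X T) k) (\<lambda>x. T k #>\<^bsub>lev X k\<^esub> x)"
proof -
  interpret Q: sgroup "squot X T" by (rule sgroup_squot[OF T])
  show ?thesis
    using proj_squot_hom[OF T] by (simp add: group_hom_def group_hom_axioms_def)
qed

lemma face_squot:
  assumes T: "normal_simplicial_subgroup X T" and "k > 0" "i \<le> k" "x \<in> carrier (lev X k)"
  shows "face (squot X T) k i (T k #>\<^bsub>lev X k\<^esub> x) = T (k - 1) #>\<^bsub>lev X (k - 1)\<^esub> face X k i x"
  unfolding face_def using assms by (intro act_squot_coset[OF sgroup T]) auto

lemma coset_eq_one_iff: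
  assumes T: "normal_simplicial_subgroup X T" and x: "x \<in> carrier (lev X k)"
  shows "T k #>\<^bsub>lev X k\<^esub> x = \<one>\<^bsub>lev (squot X T) k\<^esub> \<longleftrightarrow> x \<in> T k"
  using G.coset_join1[OF _ x nss_sub[OF T]] G.coset_join2[OF x nss_sub[OF T]]
  by (auto simp: one_squot)

lemma coset_mem_moore:
  assumes T: "normal_simplicial_subgroup X T" and x: "x \<in> carrier (moore X k)"
  shows "T k #>\<^bsub>lev X k\<^esub> x \<in> carrier (moore (squot X T) k)"
proof -
  interpret Q: sgroup "squot X T" by (rule sgroup_squot[OF T])
  have xc: "x \<in> carrier (lev X k)" using x by (simp add: mem_moore)
  show ?thesis
    unfolding Q.mem_moore
  proof (intro conjI allI impI)
    show "T k #>\<^bsub>lev X k\<^esub> x \<in> carrier (lev (squot X T) k)" using xc by (simp add: carrier_squot)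
    fix i assume i: "i < k"
    then have "face (squot X T) k i (T k #>\<^bsub>lev X k\<^esub> x) = T (k - 1) #>\<^bsub>lev X (k - 1)\<^esub> \<one>\<^bsub>lev X (k - 1)\<^esub>"
      using face_squot[OF T _ _ xc, of i] x by (simp add: mem_moore)
    also have "\<dots> = \<one>\<^bsub>lev (squot X T) (k - 1)\<^esub>"
      using coset_eq_one_iff[OF T G.one_closed] subgroup.one_closed[OF nss_sub[OF T]] by blast
    finally show "face (squot X T) k i (T k #>\<^bsub>lev X k\<^esub> x) = \<one>\<^bsub>lev (squot X T) (k - 1)\<^esub>" .
  qed
qed

text \<open>Surjectivity of \<open>N(X) \<rightarrow> N(X / T)\<close>: a representative has its
  first \<open>k\<close> faces in \<open>T\<close>, and \<open>moore_lift\<close> corrects it by a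
  factor from \<open>T k\<close>, hence within its coset.\<close>

lemma moore_squot_lift:
  assumes T: "normal_simplicial_subgroup X T" and C: "C \<in> carrier (moore (squot X T) k)"
  obtains x where "x \<in> carrier (moore X k)" "C = T k #>\<^bsub>lev X k\<^esub> x"
proof -
  interpret Q: sgroup "squot X T" by (rule sgroup_squot[OF T])
  interpret q: group_hom "lev X k" "lev (squot X T) k" "\<lambda>x. T k #>\<^bsub>lev X k\<^esub> x"
    by (rule proj_group_hom[OF T])
  obtain x where x: "x \<in> carrier (lev X k)" "C = T k #>\<^bsub>lev X k\<^esub> x"
    using C by (auto simp: Q.mem_moore carrier_squot)
  have "face X k i x \<in> T (k - 1)" if i: "i < k" for i
  proof -
    have "T (k - 1) #>\<^bsub>lev X (k - 1)\<^esub> face X k i x = \<one>\<^bsub>lev (squot X T) (k - 1)\<^esub>"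
      using face_squot[OF T _ _ x(1), of i] C i x(2) by (simp add: Q.mem_moore)
    then show ?thesis
      using coset_eq_one_iff[OF T face_closed[OF _ _ x(1), of i]] i by simp
  qed
  then obtain t where t: "t \<in> T k" "x \<otimes>\<^bsub>lev X k\<^esub> t \<in> carrier (moore X k)"
    using moore_lift[OF T x(1)] by blast
  have tc: "t \<in> carrier (lev X k)" using subgroup.mem_carrier[OF nss_sub[OF T] t(1)] .
  have "T k #>\<^bsub>lev X k\<^esub> t = \<one>\<^bsub>lev (squot X T) k\<^esub>"
    using coset_eq_one_iff[OF T tc] t(1) by simp
  then have "T k #>\<^bsub>lev X k\<^esub> (x \<otimes>\<^bsub>lev X k\<^esub> t) = C"
    using q.hom_mult[OF x(1) tc] q.hom_closed[OF x(1)] x(2) by simp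
  then show thesis using that t(2) by blast
qed

text \<open>A cycle of the quotient need not lift to a cycle: the last face of the lift is only
  known to lie in \<open>T\<close>. The consequences differ above and below the cut.\<close>

lemma cycles_squot_lift:
  assumes T: "normal_simplicial_subgroup X T" and C: "C \<in> moore_cycles (squot X T) k"
  obtains x where "x \<in> carrier (moore X k)" "C = T k #>\<^bsub>lev X k\<^esub> x"
    "k > 0 \<Longrightarrow> face X k k x \<in> T (k - 1)"
proof -
  interpret Q: sgroup "squot X T" by (rule sgroup_squot[OF T])
  obtain x where x: "x \<in> carrier (moore X k)" "C = T k #>\<^bsub>lev X k\<^esub> x"
    using moore_squot_lift[OF T] C Q.mem_moore_cycles by blast
  have xc: "x \<in> carrier (lev X k)" using x by (simp add: mem_moore)
  have "face X k k x \<in> T (k - 1)" if k: "k > 0"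
    using face_squot[OF T k order.refl xc] coset_eq_one_iff[OF T face_closed[OF k order.refl xc]] C k x(2)
    by (simp add: Q.mem_moore_cycles)
  then show thesis using that x by blast
qed

text \<open>Lifts of cycles lie in \<open>T\<close>: by the preimage condition of
  \<open>cuts\<close> in dimension \<open>n + 1\<close>, and because \<open>T\<close> contains the
  Moore complex above. So every cycle is the identity coset.\<close>

lemma homotopy_group_squot_above:
  assumes c: "cuts n X T" and i: "i > n"
  shows "trivial_group (homotopy_group i (squot X T))"
proof -
  note T = cutsD(1)[OF c]
  interpret Q: sgroup "squot X T" by (rule sgroup_squot[OF T])
  show ?thesis
  proof (rule Q.trivial_homotopy_group, rule subsetI)
    fix C assume C: "C \<in> moore_cycles (squot X T) i"
    obtain x where x: "x \<in> carrier (moore X i)" "C = T i #>\<^bsub>lev X i\<^esub> x"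
        "i > 0 \<Longrightarrow> face X i i x \<in> T (i - 1)"
      using cycles_squot_lift[OF T C] by blast
    have "x \<in> T i"
      using x i cutsD(4,5)[OF c] by (cases "i = Suc n") auto
    then have "C = \<one>\<^bsub>lev (squot X T) i\<^esub>"
      using coset_eq_one_iff[OF T, of x i] x by (simp add: mem_moore)
    then show "C \<in> moore_boundaries (squot X T) i"
      using subgroup.one_closed[OF normal_imp_subgroup[OF Q.normal_boundaries[of i]]] by simp
  qed
qed

text \<open>The projection induces the map on homology. \<open>cyc\<close> turns lifts of cycles
  into cycles of \<open>X\<close>, which gives surjectivity; \<open>bnd\<close> identifies the
  kernel with the boundaries of \<open>X\<close>, and the first isomorphism theorem applies.\<close>

lemma homotopy_group_squot_iso:
  assumes T: "normal_simplicial_subgroup X T"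
    and cyc: "\<And>x. \<lbrakk>x \<in> carrier (moore X i); i > 0; face X i i x \<in> T (i - 1)\<rbrakk>
       \<Longrightarrow> face X i i x = \<one>\<^bsub>lev X (i - 1)\<^esub>"
    and bnd: "T i \<inter> carrier (moore X i) \<subseteq> moore_boundaries X i"
  shows "homotopy_group i X \<cong> homotopy_group i (squot X T)"
proof -
  interpret Q: sgroup "squot X T" by (rule sgroup_squot[OF T])
  interpret q: group_hom "lev X k" "lev (squot X T) k" "\<lambda>x. T k #>\<^bsub>lev X k\<^esub> x" for k
    by (rule proj_group_hom[OF T])
  let ?Z = "(lev X i)\<lparr>carrier := moore_cycles X i\<rparr>"
  let ?C = "(lev (squot X T) i)\<lparr>carrier := moore_cycles (squot X T) i\<rparr>"
  let ?B = "moore_boundaries (squot X T) i"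
  let ?q = "\<lambda>x. T i #>\<^bsub>lev X i\<^esub> x"
  define h where "h = (\<lambda>x. ?B #>\<^bsub>?C\<^esub> ?q x)"
  interpret B: normal ?B ?C by (rule Q.normal_boundaries_in_cycles)
  have Zc: "moore_cycles X i \<subseteq> carrier (lev X i)"
    using subgroup.subset[OF subgroup_cycles] .
  have qZ: "?q x \<in> moore_cycles (squot X T) i" if x: "x \<in> moore_cycles X i" for x
  proof -
    have "face (squot X T) i i (?q x) = \<one>\<^bsub>lev (squot X T) (i - 1)\<^esub>" if "i > 0"
      using that x Zc face_squot[OF T that order.refl, of x] q.hom_one by (auto simp: mem_moore_cycles)
    then show ?thesis
      using x coset_mem_moore[OF T] by (simp add: Q.mem_moore_cycles mem_moore_cycles)
  qed
  have "h \<in> hom ?Z (homotopy_group i (squot X T))"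
  proof -
    have "?q \<in> hom ?Z ?C"
      using qZ Zc by (intro homI) (auto simp: subset_iff)
    from hom_compose[OF this B.r_coset_hom_Mod] show ?thesis
      by (simp add: h_def homotopy_group_def comp_def)
  qed
  then interpret h: group_hom ?Z "homotopy_group i (squot X T)" h
    using G.subgroup_imp_group[OF subgroup_cycles] Q.group_homotopy_group
    by (simp add: group_hom_def group_hom_axioms_def)
  have surj: "h ` carrier ?Z = carrier (homotopy_group i (squot X T))"
  proof
    show "carrier (homotopy_group i (squot X T)) \<subseteq> h ` carrier ?Z"
    proof
      fix D assume "D \<in> carrier (homotopy_group i (squot X T))"
      then obtain C where C: "C \<in> moore_cycles (squot X T) i" "D = ?B #>\<^bsub>?C\<^esub> C"
        by (auto simp: homotopy_group_def FactGroup_def RCOSETS_def)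
      obtain x where x: "x \<in> carrier (moore X i)" "C = ?q x" "i > 0 \<Longrightarrow> face X i i x \<in> T (i - 1)"
        using cycles_squot_lift[OF T C(1)] by blast
      then have "x \<in> moore_cycles X i" using cyc by (simp add: mem_moore_cycles)
      then show "D \<in> h ` carrier ?Z" using C(2) x(2) by (auto simp: h_def)
    qed
  qed (use h.hom_closed in blast)
  have ker: "kernel ?Z (homotopy_group i (squot X T)) h = moore_boundaries X i"
  proof -
    have one: "h x = \<one>\<^bsub>homotopy_group i (squot X T)\<^esub> \<longleftrightarrow> ?q x \<in> ?B" if "x \<in> moore_cycles X i" for x
      using B.coset_join1[OF _ _ B.subgroup_axioms, of "?q x"]
        B.coset_join2[OF _ B.subgroup_axioms, of "?q x"] qZ[OF that]
      by (auto simp: h_def homotopy_group_def FactGroup_def)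
    have "?q x \<in> ?B \<longleftrightarrow> x \<in> moore_boundaries X i" if x: "x \<in> moore_cycles X i" for x
    proof
      assume "x \<in> moore_boundaries X i"
      then obtain y where y: "y \<in> carrier (moore X (Suc i))" "x = face X (Suc i) (Suc i) y"
        by (auto simp: mem_moore_boundaries)
      then have qx: "?q x = face (squot X T) (Suc i) (Suc i) (T (Suc i) #>\<^bsub>lev X (Suc i)\<^esub> y)"
        using face_squot[OF T, of "Suc i" "Suc i" y] by (simp add: mem_moore)
      then show "?q x \<in> ?B"
        using bexI[where x = "T (Suc i) #>\<^bsub>lev X (Suc i)\<^esub> y"] coset_mem_moore[OF T y(1)]
        by (auto simp: Q.mem_moore_boundaries)
    next
      assume "?q x \<in> ?B"
      then obtain C where C: "C \<in> carrier (moore (squot X T) (Suc i))"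
          "?q x = face (squot X T) (Suc i) (Suc i) C"
        by (auto simp: Q.mem_moore_boundaries)
      obtain y where y: "y \<in> carrier (moore X (Suc i))" "C = T (Suc i) #>\<^bsub>lev X (Suc i)\<^esub> y"
        using moore_squot_lift[OF T C(1)] .
      \<comment> \<open>\<open>z\<close> is a true boundary congruent to \<open>x\<close> modulo
        \<open>T\<close>, so \<open>x\<close> differs from it by a Moore element of
        \<open>T\<close>, which is a boundary by \<open>bnd\<close>.\<close>
      define z where "z = face X (Suc i) (Suc i) y"
      have zB: "z \<in> moore_boundaries X i" using y(1) by (auto simp: z_def mem_moore_boundaries)
      then have zZ: "z \<in> moore_cycles X i" using moore_boundaries_cycles by blast
      have xz: "x \<in> carrier (lev X i)" "z \<in> carrier (lev X i)" using x zZ Zc by auto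
      have qz: "?q x = ?q z"
        using face_squot[OF T, of "Suc i" "Suc i" y] C(2) y by (simp add: z_def mem_moore)
      have "?q (x \<otimes>\<^bsub>lev X i\<^esub> inv\<^bsub>lev X i\<^esub> z) = ?q z \<otimes>\<^bsub>lev (squot X T) i\<^esub> inv\<^bsub>lev (squot X T) i\<^esub> ?q z"
        using xz qz by simp
      also have "\<dots> = \<one>\<^bsub>lev (squot X T) i\<^esub>"
        using q.hom_closed[OF xz(2)] by simp
      finally have "x \<otimes>\<^bsub>lev X i\<^esub> inv\<^bsub>lev X i\<^esub> z \<in> T i"
        using coset_eq_one_iff[OF T, of "x \<otimes>\<^bsub>lev X i\<^esub> inv\<^bsub>lev X i\<^esub> z" i] xz by simp
      moreover have "x \<otimes>\<^bsub>lev X i\<^esub> inv\<^bsub>lev X i\<^esub> z \<in> carrier (moore X i)"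
        using x zZ subgroup.m_closed[OF subgroup_cycles] subgroup.m_inv_closed[OF subgroup_cycles]
        by (metis mem_moore_cycles)
      ultimately have "x \<otimes>\<^bsub>lev X i\<^esub> inv\<^bsub>lev X i\<^esub> z \<in> moore_boundaries X i" using bnd by blast
      from subgroup.m_closed[OF normal_imp_subgroup[OF normal_boundaries] this zB]
      show "x \<in> moore_boundaries X i" using xz by (simp add: G.m_assoc)
    qed
    then show ?thesis
      using one moore_boundaries_cycles[of i] by (auto simp: kernel_def)
  qed
  show ?thesis
    using h.FactGroup_iso[OF surj] unfolding ker by (simp add: homotopy_group_def)
qed

lemma cuts_Int_moore_boundaries:
  assumes c: "cuts n X T" and i: "i \<le> n"
  shows "T i \<inter> carrier (moore X i) \<subseteq> moore_boundaries X i"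
proof (cases "i = n")
  case True
  then show ?thesis using cutsD(3)[OF c] by (auto simp: moore_boundaries_def moore_diff_def)
next
  case False
  then have "T i \<inter> carrier (moore X i) \<subseteq> {\<one>\<^bsub>lev X i\<^esub>}"
    using cutsD(2)[OF c] i by auto
  then show ?thesis
    using subgroup.one_closed[OF normal_imp_subgroup[OF normal_boundaries[of i]]] by blast
qed

lemma homotopy_group_squot_below:
  assumes c: "cuts n X T" and i: "i \<le> n"
  shows "homotopy_group i X \<cong> homotopy_group i (squot X T)"
proof (rule homotopy_group_squot_iso[OF cutsD(1)[OF c] _ cuts_Int_moore_boundaries[OF c i]])
  fix x assume x: "x \<in> carrier (moore X i)" "i > 0" "face X i i x \<in> T (i - 1)"
  \<comment> \<open>The last face is thus a Moore element of \<open>T\<close> in dimension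
    \<open>i - 1 < n\<close>, where \<open>cuts\<close> leaves only the identity.\<close>
  have "face X i i x \<in> carrier (moore X (i - 1))"
    using last_face_moore[OF x(2,1)] mem_moore_cycles by blast
  then show "face X i i x = \<one>\<^bsub>lev X (i - 1)\<^esub>"
    using cutsD(2)[OF c _ x(3)] x(2) i by simp
qed

text \<open>With this, \<open>S / T\<close> is covered by the results on quotients,
  \<open>ssub X S\<close> taking the role of \<open>X\<close>. Since \<open>T\<close> lies in
  \<open>S\<close>, intersecting the Moore complex with \<open>S\<close> does not change its
  intersection with \<open>T\<close>.\<close>

lemma cuts_ssub:
  assumes c: "cuts m X T" and S: "normal_simplicial_subgroup X S" and le: "\<And>k. T k \<subseteq> S k"
  shows "cuts m (ssub X S) T"
proof -
  note T = cutsD(1)[OF c]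
  note mo = carrier_moore_ssub[OF S]
  have "T k \<lhd> lev (ssub X S) k" for k
    unfolding lev_ssub
    by (rule G.normal_restrict_supergroup[OF nss_sub[OF S] normal_simplicial_subgroupD(1)[OF T] le])
  then have "normal_simplicial_subgroup (ssub X S) T"
    using normal_simplicial_subgroupD(2)[OF T]
    by (auto simp: normal_simplicial_subgroup_def act_ssub)
  then show ?thesis
    unfolding cuts_def mo face_ssub
  proof (intro conjI allI impI ballI)
    show "T k \<inter> (S k \<inter> carrier (moore X k)) \<subseteq> {\<one>\<^bsub>lev (ssub X S) k\<^esub>}" if "k < m" for k
      using cutsD(2)[OF c that] by (auto simp: lev_ssub)
    have "T (Suc m) \<inter> carrier (moore X (Suc m)) = T (Suc m) \<inter> (S (Suc m) \<inter> carrier (moore X (Suc m)))"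
      using le[of "Suc m"] by blast
    then show "T m \<inter> (S m \<inter> carrier (moore X m))
        \<subseteq> face X (Suc m) (Suc m) ` (T (Suc m) \<inter> (S (Suc m) \<inter> carrier (moore X (Suc m))))"
      using cutsD(3)[OF c] by auto
  qed (use cutsD(4,5)[OF c] in auto)
qed

text \<open>Compared on Moore complexes: up to dimension \<open>n\<close>, \<open>T\<close> has only
  the identity there; from \<open>n + 1\<close> to \<open>m\<close> its elements are boundaries,
  hence cycles, which \<open>S\<close> contains; beyond \<open>m\<close>, \<open>S\<close> contains
  everything.\<close>

lemma cuts_subset:
  assumes S: "cuts n X S" and T: "cuts m X T" and nm: "n < m"
  shows "T k \<subseteq> S k"
proof (rule nss_subset_if_moore_subset[OF cutsD(1)[OF S] cutsD(1)[OF T]])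
  fix k
  show "T k \<inter> carrier (moore X k) \<subseteq> S k"
  proof (cases "k \<le> m")
    case True
    show ?thesis
    proof (cases "k > n")
      case True
      then show ?thesis
        using cuts_Int_moore_boundaries[OF T \<open>k \<le> m\<close>] moore_boundaries_cycles
          cuts_cycles_subset[OF S True] by blast
    next
      case False
      then show ?thesis
        using cutsD(2)[OF T, of k] nm subgroup.one_closed[OF nss_sub[OF cutsD(1)[OF S], of k]] by auto
    qed
  next
    case False
    then show ?thesis using cutsD(5)[OF S, of k] nm by auto
  qed
qed

end

section \<open>The radicals\<close>

context sgroup
begin

text \<open>By pigeonhole the operator misses some \<open>i \<le> n + 1\<close>. The face
  \<open>d_i x\<close> is trivial if \<open>i < k\<close>; otherwise \<open>i = k = n + 1\<close>
  and \<open>last\<close> applies.\<close>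

lemma act_moore_mem:
  assumes T: "normal_simplicial_subgroup X T" and x: "x \<in> carrier (moore X k)" and k: "k > n"
    and last: "k = Suc n \<Longrightarrow> face X k k x \<in> T n" and j: "j \<le> n" and t: "\<theta> \<in> Delta j k"
  shows "act X j k \<theta> x \<in> T j"
proof -
  have xc: "x \<in> carrier (lev X k)" using x by (simp add: mem_moore)
  obtain i where i: "i \<le> Suc n" "i \<notin> \<theta> ` {..j}"
    using ex_not_in_image[of j "Suc n" \<theta>] j by auto
  have "face X k i x \<in> T (k - 1)"
  proof (cases "i < k")
    case True
    then show ?thesis using x subgroup.one_closed[OF nss_sub[OF T]] by (simp add: mem_moore)
  next
    case False
    then have "i = k" "k = Suc n" using i k by auto
    then show ?thesis using last by simp
  qed
  then show ?thesis using i k by (intro act_mem_if_misses[OF T t xc _ i(2)]) auto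
qed

section \<open>The coskeletal radical\<close>

lemma mem_rad_cosk:
  "x \<in> rad_cosk (Suc n) X k \<longleftrightarrow>
     x \<in> carrier (lev X k) \<and> (\<forall>j\<le>n. \<forall>\<theta>\<in>Delta j k. act X j k \<theta> x = \<one>\<^bsub>lev X j\<^esub>)"
  by (auto simp: rad_cosk_def skernel_def kernel_def cosk_unit_def one_cosk fun_eq_iff restrict_def tr_def)

lemma cuts_rad_cosk: "cuts n X (rad_cosk (Suc n) X)"
  unfolding cuts_def
proof (intro conjI allI impI ballI)
  show T: "normal_simplicial_subgroup X (rad_cosk (Suc n) X)"
    by (rule normal_simplicial_subgroup_rad(2)[OF sgroup])
  \<comment> \<open>For \<open>k \<le> n\<close> the identity operator is among those that must kill
    \<open>x\<close>.\<close>
  have low: "x = \<one>\<^bsub>lev X k\<^esub>" if "x \<in> rad_cosk (Suc n) X k" "k \<le> n" for x k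
    using that act_id[of x k] by (auto simp: mem_rad_cosk)
  show "rad_cosk (Suc n) X k \<inter> carrier (moore X k) \<subseteq> {\<one>\<^bsub>lev X k\<^esub>}" if "k < n" for k
    using low[of _ k] that by auto
  have "\<one>\<^bsub>lev X n\<^esub> = face X (Suc n) (Suc n) \<one>\<^bsub>lev X (Suc n)\<^esub>"
    using group_hom.hom_one[OF face_group_hom[of "Suc n" "Suc n"]] by simp
  moreover have "\<one>\<^bsub>lev X (Suc n)\<^esub> \<in> rad_cosk (Suc n) X (Suc n) \<inter> carrier (moore X (Suc n))"
    using subgroup.one_closed[OF nss_sub[OF T]] subgroup.one_closed[OF subgroup_moore] by blast
  ultimately show "rad_cosk (Suc n) X n \<inter> carrier (moore X n)
      \<subseteq> face X (Suc n) (Suc n) ` (rad_cosk (Suc n) X (Suc n) \<inter> carrier (moore X (Suc n)))"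
    using low[of _ n] by blast
  \<comment> \<open>In dimension \<open>n\<close> the radical is trivial, so a last face in it is
    the identity, and \<open>act_moore_mem\<close> applies with the trivial subgroup.\<close>
  have mem: "x \<in> rad_cosk (Suc n) X k"
    if x: "x \<in> carrier (moore X k)" and k: "k > n"
      and last: "k = Suc n \<Longrightarrow> face X k k x \<in> rad_cosk (Suc n) X n" for x k
    using act_moore_mem[OF nss_trivial x k] last low[of _ n] x
    by (auto simp: mem_rad_cosk[of x] mem_moore)
  show "x \<in> rad_cosk (Suc n) X (Suc n)"
    if "x \<in> carrier (moore X (Suc n))" "face X (Suc n) (Suc n) x \<in> rad_cosk (Suc n) X n" for x
    using mem that by simp
  show "carrier (moore X k) \<subseteq> rad_cosk (Suc n) X k" if "k > Suc n" for k
    using mem that by auto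
qed

section \<open>The radical of the reflection \<open>Cot\<close>\<close>

text \<open>
  Since \<open>\<mu>\<^sub>n\<^sub>\<ge>(X)\<close> is the least normal simplicial subgroup with quotient in \<open>in_M n\<close>, it is bounded
  by exhibiting one whose Moore complex is \<open>\<delta>(N(X)\<^sub>n\<^sub>+\<^sub>1)\<close> in dimension \<open>n\<close> and trivial below.
\<close>

definition cot_bound :: "nat \<Rightarrow> nat \<Rightarrow> 'a set" where
  "cot_bound n k = {x \<in> carrier (lev X k). \<forall>j\<le>n. \<forall>\<theta>\<in>Delta j k.
     act X j k \<theta> x \<in> (if j = n then moore_boundaries X n else {\<one>\<^bsub>lev X j\<^esub>})}"

text \<open>Each condition asks that an operator send \<open>x\<close> into a normal subgroup, so
  together they cut out a normal subgroup. It is stable under operators because the condition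
  depends only on the source dimension, which composition preserves.\<close>

lemma nss_cot_bound: "normal_simplicial_subgroup X (cot_bound n)"
proof (rule nssI)
  let ?E = "\<lambda>j. if j = n then moore_boundaries X n else {\<one>\<^bsub>lev X j\<^esub>}"
  have E: "?E j \<lhd> lev X j" for j
    using normal_boundaries G.one_is_normal by simp
  note Es = normal_imp_subgroup[OF E]
  show "cot_bound n k \<lhd> lev X k" for k
  proof (rule G.normal_invI)
    have hom: "group_hom (lev X k) (lev X j) (act X j k \<theta>)" if "\<theta> \<in> Delta j k" for j \<theta>
      using act_group_hom[OF that] .
    show "subgroup (cot_bound n k) (lev X k)"
    proof (rule G.subgroupI)
      show "cot_bound n k \<subseteq> carrier (lev X k)" by (auto simp: cot_bound_def)
      have "\<one>\<^bsub>lev X k\<^esub> \<in> cot_bound n k"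
        unfolding cot_bound_def using group_hom.hom_one[OF hom] subgroup.one_closed[OF Es] by simp
      then show "cot_bound n k \<noteq> {}" by blast
      show "inv\<^bsub>lev X k\<^esub> x \<in> cot_bound n k" if "x \<in> cot_bound n k" for x
        using that group_hom.hom_inv[OF hom] subgroup.m_inv_closed[OF Es]
        unfolding cot_bound_def by simp
      show "x \<otimes>\<^bsub>lev X k\<^esub> y \<in> cot_bound n k" if "x \<in> cot_bound n k" "y \<in> cot_bound n k" for x y
        using that group_hom.hom_mult[OF hom] subgroup.m_closed[OF Es]
        unfolding cot_bound_def by simp
    qed
    fix x h assume x: "x \<in> carrier (lev X k)" and h: "h \<in> cot_bound n k"
    have hc: "h \<in> carrier (lev X k)" using h by (simp add: cot_bound_def)
    have "act X j k \<theta> (x \<otimes>\<^bsub>lev X k\<^esub> h \<otimes>\<^bsub>lev X k\<^esub> inv\<^bsub>lev X k\<^esub> x) \<in> ?E j"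
      if j: "j \<le> n" and t: "\<theta> \<in> Delta j k" for j \<theta>
    proof -
      interpret a: group_hom "lev X k" "lev X j" "act X j k \<theta>" by (rule hom[OF t])
      have "act X j k \<theta> h \<in> ?E j" using h j t by (simp add: cot_bound_def)
      then show ?thesis
        using normal.inv_op_closed2[OF E a.hom_closed[OF x]] x hc by simp
    qed
    then show "x \<otimes>\<^bsub>lev X k\<^esub> h \<otimes>\<^bsub>lev X k\<^esub> inv\<^bsub>lev X k\<^esub> x \<in> cot_bound n k"
      using x hc unfolding cot_bound_def by simp
  qed
  fix j k \<phi> x assume t: "\<phi> \<in> Delta j k" and x: "x \<in> cot_bound n k"
  have xc: "x \<in> carrier (lev X k)" using x by (simp add: cot_bound_def)
  have "act X i j \<theta> (act X j k \<phi> x) \<in> ?E i" if "i \<le> n" "\<theta> \<in> Delta i j" for i \<theta>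
    using x that Delta_compose[OF that(2) t] act_comp[OF that(2) t xc, symmetric]
    unfolding cot_bound_def by simp
  then show "act X j k \<phi> x \<in> cot_bound n j"
    unfolding cot_bound_def using act_closed[OF t xc] by blast
qed

lemma cot_bound_act_id:
  assumes "x \<in> cot_bound n k" "k \<le> n"
  shows "x \<in> (if k = n then moore_boundaries X n else {\<one>\<^bsub>lev X k\<^esub>})"
proof -
  have "x \<in> carrier (lev X k)"
      "act X k k (Delta_id k) x \<in> (if k = n then moore_boundaries X n else {\<one>\<^bsub>lev X k\<^esub>})"
    using assms(1,2) Delta_id_in[of k] unfolding cot_bound_def by blast+
  then show ?thesis by (simp only: act_id)
qed

lemma cot_bound_less: "x \<in> cot_bound n k \<Longrightarrow> k < n \<Longrightarrow> x = \<one>\<^bsub>lev X k\<^esub>"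
  using cot_bound_act_id[of x n k] by simp

text \<open>An operator from \<open>[j]\<close> to \<open>[n]\<close> with \<open>j \<le> n\<close>
  is either the identity or misses a vertex; in the latter case it kills boundaries, since all their
  faces are trivial.\<close>

lemma cot_bound_eq: "cot_bound n n = moore_boundaries X n"
proof
  show "cot_bound n n \<subseteq> moore_boundaries X n"
    using cot_bound_act_id[of _ n n] by auto
  show "moore_boundaries X n \<subseteq> cot_bound n n"
  proof
    fix x assume x: "x \<in> moore_boundaries X n"
    then have cyc: "x \<in> moore_cycles X n" using moore_boundaries_cycles by blast
    then have xc: "x \<in> carrier (lev X n)" by (simp add: mem_moore_cycles mem_moore)
    have faces: "face X n i x = \<one>\<^bsub>lev X (n - 1)\<^esub>" if "n > 0" "i \<le> n" for i
      using cyc that by (cases "i = n") (auto simp: mem_moore_cycles mem_moore)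
    have "act X j n \<theta> x \<in> (if j = n then moore_boundaries X n else {\<one>\<^bsub>lev X j\<^esub>})"
      if j: "j \<le> n" and t: "\<theta> \<in> Delta j n" for j \<theta>
    proof (cases "\<forall>i\<le>n. i \<in> \<theta> ` {..j}")
      case True
      then have "j = n" using ex_not_in_image[of j n \<theta>] j by (metis le_neq_implies_less)
      then show ?thesis using True Delta_surj_id[of \<theta> n] t x xc by (simp add: act_id)
    next
      case False
      then obtain i where i: "i \<le> n" "i \<notin> \<theta> ` {..j}" by blast
      have "n > 0"
        using i Delta_mem[OF t, of 0] by (cases n) auto
      then have "act X j n \<theta> x = \<one>\<^bsub>lev X j\<^esub>"
        by (intro act_one_if_misses[OF t xc i] faces i(1))
      then show ?thesis
        using subgroup.one_closed[OF normal_imp_subgroup[OF normal_boundaries]] by simp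
    qed
    then show "x \<in> cot_bound n n" using xc unfolding cot_bound_def by blast
  qed
qed

text \<open>A factor from \<open>cot_bound\<close> moves \<open>x\<close> into the Moore complex. If
  \<open>k = n + 1\<close>, its last face is then a boundary and so lies in
  \<open>cot_bound n n\<close>. Hence operators from dimensions up to \<open>n\<close> send it into
  \<open>cot_bound\<close>, which there is as small as its definition demands.\<close>

lemma in_M_squot_cot_bound: "in_M n (squot X (cot_bound n))"
proof (rule in_M_sub[OF sgroup nss_cot_bound])
  fix k x assume k: "k > n" and x: "x \<in> carrier (lev X k)"
    and d: "\<And>i. i < k \<Longrightarrow> face X k i x \<in> cot_bound n (k - 1)"
  note U = nss_cot_bound[of n]
  obtain t where t: "t \<in> cot_bound n k" and xt: "x \<otimes>\<^bsub>lev X k\<^esub> t \<in> carrier (moore X k)"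
    using moore_lift[OF U x d] .
  have tc: "t \<in> carrier (lev X k)" using subgroup.mem_carrier[OF nss_sub[OF U] t] .
  have "act X j k \<theta> (x \<otimes>\<^bsub>lev X k\<^esub> t) \<in> cot_bound n j" if "j \<le> n" "\<theta> \<in> Delta j k" for j \<theta>
    using that xt by (intro act_moore_mem[OF U xt k]) (auto simp: cot_bound_eq mem_moore_boundaries)
  then have "act X j k \<theta> (x \<otimes>\<^bsub>lev X k\<^esub> t) \<in> (if j = n then moore_boundaries X n else {\<one>\<^bsub>lev X j\<^esub>})"
    if "j \<le> n" "\<theta> \<in> Delta j k" for j \<theta>
    using cot_bound_act_id that by blast
  then have "x \<otimes>\<^bsub>lev X k\<^esub> t \<in> cot_bound n k"
    unfolding cot_bound_def using x tc by simp
  from subgroup.m_closed[OF nss_sub[OF U] this subgroup.m_inv_closed[OF nss_sub[OF U] t]]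
  show "x \<in> cot_bound n k" using x tc by (simp add: G.m_assoc)
qed

text \<open>The projection to \<open>X / S\<close> factors through the unit of
  \<open>Cot n X\<close>, so whatever the unit kills lies in \<open>S\<close>.\<close>

lemma rad_cot_least:
  assumes S: "normal_simplicial_subgroup X S" and M: "in_M n (squot X S)"
  shows "rad_cot n X k \<subseteq> S k"
proof
  fix x assume x: "x \<in> rad_cot n X k"
  have xc: "x \<in> carrier (lev X k)" using x by (simp add: rad_cot_def skernel_def kernel_def)
  interpret Q: sgroup "squot X S" by (rule sgroup_squot[OF S])
  interpret C: sgroup "Cot n X"
    using is_Cot_Cot[OF sgroup, of n] by (simp add: sgroup_def is_Cot_def in_M_def)
  have "factors_uniquely X (Cot n X) (Cot_unit n X) (squot X S) (\<lambda>k x. S k #>\<^bsub>lev X k\<^esub> x)"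
    using is_Cot_Cot[OF sgroup, of n] M shom_proj_squot[OF sgroup S] by (simp add: is_Cot_def)
  then obtain g where g: "shom (Cot n X) (squot X S) g"
      "\<And>k x. x \<in> carrier (lev X k) \<Longrightarrow> g k (Cot_unit n X k x) = S k #>\<^bsub>lev X k\<^esub> x"
    by (rule factors_uniquelyE) blast
  have "S k #>\<^bsub>lev X k\<^esub> x = g k \<one>\<^bsub>lev (Cot n X) k\<^esub>"
    using g(2)[OF xc] x by (simp add: rad_cot_def skernel_def kernel_def)
  also have "\<dots> = \<one>\<^bsub>lev (squot X S) k\<^esub>"
    by (rule hom_one[OF shom_onD(1)[OF g(1)] C.G.is_group Q.G.is_group]) simp
  finally show "x \<in> S k" using coset_eq_one_iff[OF S xc] by simp
qed

text \<open>The quotient by the kernel of a morphism into an object of \<open>in_M n\<close> is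
  again in \<open>in_M n\<close>; so an element above dimension \<open>n\<close> with trivial first
  faces lies in that kernel.\<close>

lemma moore_subset_rad_cot:
  assumes "k > n"
  shows "carrier (moore X k) \<subseteq> rad_cot n X k"
proof
  fix x assume x: "x \<in> carrier (moore X k)"
  have T: "normal_simplicial_subgroup X (rad_cot n X)"
    by (rule normal_simplicial_subgroup_rad(1)[OF sgroup])
  have "in_M n (squot X (rad_cot n X))"
    unfolding rad_cot_def using is_Cot_Cot[OF sgroup, of n]
    by (intro in_M_squot_skernel[OF sgroup]) (auto simp: is_Cot_def)
  then show "x \<in> rad_cot n X k"
    using x subgroup.one_closed[OF nss_sub[OF T]]
    by (intro in_M_squot_mem[OF sgroup T _ assms]) (auto simp: mem_moore)
qed

lemma cuts_rad_cot: "cuts n X (rad_cot n X)"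
  unfolding cuts_def
proof (intro conjI allI impI ballI)
  note le = rad_cot_least[OF nss_cot_bound in_M_squot_cot_bound]
  show "normal_simplicial_subgroup X (rad_cot n X)"
    by (rule normal_simplicial_subgroup_rad(1)[OF sgroup])
  show "rad_cot n X k \<inter> carrier (moore X k) \<subseteq> {\<one>\<^bsub>lev X k\<^esub>}" if "k < n" for k
    using le[of n k] cot_bound_less[OF _ that] by blast
  \<comment> \<open>Fillings in dimension \<open>n + 1\<close> are thereby unrestricted, so the
    bound by all boundaries of \<open>X\<close> from \<open>cot_bound\<close> suffices in dimension
    \<open>n\<close>.\<close>
  have "rad_cot n X (Suc n) \<inter> carrier (moore X (Suc n)) = carrier (moore X (Suc n))"
    using moore_subset_rad_cot[of n "Suc n"] by auto
  then show "rad_cot n X n \<inter> carrier (moore X n)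
      \<subseteq> face X (Suc n) (Suc n) ` (rad_cot n X (Suc n) \<inter> carrier (moore X (Suc n)))"
    using le[of n n] cot_bound_eq[of n] by (auto simp: moore_boundaries_def moore_diff_def)
  show "x \<in> rad_cot n X (Suc n)" if "x \<in> carrier (moore X (Suc n))" for x
    using moore_subset_rad_cot[of n "Suc n"] that by auto
  show "carrier (moore X k) \<subseteq> rad_cot n X k" if "k > Suc n" for k
    using moore_subset_rad_cot[of n k] that by simp
qed

text \<open>Both radicals cut at the same dimension, whereas \<open>cuts_subset\<close> compares
  different ones. Here the smaller one is trivial up to dimension \<open>n\<close>, and the larger
  contains the Moore complex above.\<close>

lemma rad_cosk_subset_rad_cot: "rad_cosk (Suc n) X k \<subseteq> rad_cot n X k"
proof (rule nss_subset_if_moore_subset[OF cutsD(1)[OF cuts_rad_cot] cutsD(1)[OF cuts_rad_cosk]])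
  fix k
  show "rad_cosk (Suc n) X k \<inter> carrier (moore X k) \<subseteq> rad_cot n X k"
  proof (cases "k \<le> n")
    case True
    have "x = \<one>\<^bsub>lev X k\<^esub>" if "x \<in> rad_cosk (Suc n) X k" for x
      using that True act_id[of x k] by (auto simp: mem_rad_cosk)
    then show ?thesis
      using subgroup.one_closed[OF nss_sub[OF cutsD(1)[OF cuts_rad_cot[of n]], of k]] by auto
  next
    case False
    then show ?thesis using moore_subset_rad_cot[of n k] by auto
  qed
qed

text \<open>Passing to \<open>S\<close> removes the homotopy up to dimension \<open>n\<close>, and
  dividing by \<open>T\<close> removes it above \<open>m\<close>.\<close>

lemma homotopy_group_rad_quot:
  assumes S: "cuts n X S" and T: "cuts m X T" and le: "\<And>k. T k \<subseteq> S k"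
  shows "group (homotopy_group i (rad_quot X S T))"
    and "n < i \<and> i \<le> m \<Longrightarrow> homotopy_group i (rad_quot X S T) \<cong> homotopy_group i X"
    and "\<not> (n < i \<and> i \<le> m) \<Longrightarrow> trivial_group (homotopy_group i (rad_quot X S T))"
proof -
  interpret Y: sgroup "ssub X S" by (rule sgroup_ssub[OF cutsD(1)[OF S]])
  have c: "cuts m (ssub X S) T" by (rule cuts_ssub[OF T cutsD(1)[OF S] le])
  interpret Q: sgroup "rad_quot X S T"
    unfolding rad_quot_def by (rule Y.sgroup_squot[OF cutsD(1)[OF c]])
  show grp: "group (homotopy_group i (rad_quot X S T))" by (rule Q.group_homotopy_group)
  have below: "homotopy_group i (ssub X S) \<cong> homotopy_group i (rad_quot X S T)" if "i \<le> m"
    unfolding rad_quot_def by (rule Y.homotopy_group_squot_below[OF c that])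
  show "homotopy_group i (rad_quot X S T) \<cong> homotopy_group i X" if "n < i \<and> i \<le> m"
    using below homotopy_group_ssub_above[OF S, of i] that
      group.iso_sym[OF group_homotopy_group] by simp
  show "trivial_group (homotopy_group i (rad_quot X S T))" if "\<not> (n < i \<and> i \<le> m)"
  proof (cases "i \<le> m")
    case True
    then show ?thesis
      using isomorphic_group_triviality1[OF below grp] homotopy_group_ssub_below[OF S] that by simp
  next
    case False
    then show ?thesis
      unfolding rad_quot_def by (intro Y.homotopy_group_squot_above[OF c]) simp
  qed
qed

end

section \<open>Assembling the six statements\<close>

lemma iso_trivial_groups:
  assumes "trivial_group G" "trivial_group H"
  shows "G \<cong> H"
proof -
  have "(\<lambda>x. \<one>\<^bsub>H\<^esub>) \<in> iso G H"
    using assms by (auto simp: trivial_group_def iso_def hom_def bij_betw_def group.is_monoid)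
  then show ?thesis by (rule is_isoI)
qed

text \<open>\<open>P\<close> will say that the degree survives; both groups are then compared
  through \<open>K\<close>, the homotopy group of \<open>X\<close>. Otherwise both are
  trivial.\<close>

lemma iso_if_common_shape:
  assumes "group H" "group K"
    and "P \<Longrightarrow> G \<cong> K" "\<not> P \<Longrightarrow> trivial_group G"
    and "P \<Longrightarrow> H \<cong> K" "\<not> P \<Longrightarrow> trivial_group H"
  shows "G \<cong> H"
  using assms iso_trans[OF _ group.iso_sym] iso_trivial_groups by blast

theorem theorem7p2:
  fixes X :: "'a sgrp"
  assumes "simplicial_group X"
  shows
   "(\<forall>n i. homotopy_group i (Pi_upper_cot n X) \<cong> homotopy_group i (Pi_upper_cosk (n + 1) X) \<and>
       (if i \<ge> n + 1
        then homotopy_group i (Pi_upper_cot n X) \<cong> homotopy_group i X \<and>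
             homotopy_group i (Pi_upper_cosk (n + 1) X) \<cong> homotopy_group i X
        else trivial_group (homotopy_group i (Pi_upper_cot n X)) \<and>
             trivial_group (homotopy_group i (Pi_upper_cosk (n + 1) X)))) \<and>
    (\<forall>n i. homotopy_group i (Pi_lower_cot n X) \<cong> homotopy_group i (Pi_lower_cosk (n + 1) X) \<and>
       (if i \<ge> n + 1
        then trivial_group (homotopy_group i (Pi_lower_cot n X)) \<and>
             trivial_group (homotopy_group i (Pi_lower_cosk (n + 1) X))
        else homotopy_group i (Pi_lower_cot n X) \<cong> homotopy_group i X \<and>
             homotopy_group i (Pi_lower_cosk (n + 1) X) \<cong> homotopy_group i X)) \<and>
    (\<forall>n i. trivial_group (homotopy_group i (Pi_cot_cosk n (n + 1) X))) \<and>
    (\<forall>n m i. m > n \<longrightarrow>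
       (if m + 1 > i \<and> i \<ge> n + 1
        then homotopy_group i (Pi_cot_cosk n (m + 1) X) \<cong> homotopy_group i X
        else trivial_group (homotopy_group i (Pi_cot_cosk n (m + 1) X)))) \<and>
    (\<forall>n m i. m > n \<longrightarrow>
       homotopy_group i (Pi_cot_cosk n (m + 1) X) \<cong> homotopy_group i (Pi_cot_cot n m X) \<and>
       homotopy_group i (Pi_cot_cot n m X) \<cong> homotopy_group i (Pi_cosk_cosk (n + 1) (m + 1) X) \<and>
       homotopy_group i (Pi_cosk_cosk (n + 1) (m + 1) X) \<cong> homotopy_group i (Pi_cosk_cot (n + 1) m X)) \<and>
    (\<forall>n i.
       (if i = n + 1
        then homotopy_group i (Pi_cot_cosk n (n + 2) X) \<cong> homotopy_group i X
        else trivial_group (homotopy_group i (Pi_cot_cosk n (n + 2) X))))"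
proof -
  interpret sgroup X by (rule sgroup.intro[OF assms])
  note piX = group_homotopy_group
  note T = cuts_rad_cot cuts_rad_cosk
  have upper: "group (homotopy_group i (ssub X U))"
      "i > n \<Longrightarrow> homotopy_group i (ssub X U) \<cong> homotopy_group i X"
      "\<not> i > n \<Longrightarrow> trivial_group (homotopy_group i (ssub X U))"
    if U: "cuts n X U" for n i U
    using sgroup.group_homotopy_group[OF sgroup_ssub[OF cutsD(1)[OF U]]]
      homotopy_group_ssub_above[OF U] homotopy_group_ssub_below[OF U] iso_refl by auto
  have lower: "group (homotopy_group i (squot X U))"
      "\<not> i > n \<Longrightarrow> homotopy_group i (squot X U) \<cong> homotopy_group i X"
      "i > n \<Longrightarrow> trivial_group (homotopy_group i (squot X U))"
    if U: "cuts n X U" for n i U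
    using sgroup.group_homotopy_group[OF sgroup_squot[OF cutsD(1)[OF U]]]
      group.iso_sym[OF piX homotopy_group_squot_below[OF U]] homotopy_group_squot_above[OF U] by auto
  have 1: "homotopy_group i (Pi_upper_cot n X) \<cong> homotopy_group i (Pi_upper_cosk (n + 1) X) \<and>
       (if i \<ge> n + 1
        then homotopy_group i (Pi_upper_cot n X) \<cong> homotopy_group i X \<and>
             homotopy_group i (Pi_upper_cosk (n + 1) X) \<cong> homotopy_group i X
        else trivial_group (homotopy_group i (Pi_upper_cot n X)) \<and>
             trivial_group (homotopy_group i (Pi_upper_cosk (n + 1) X)))" for n i
  proof -
    have "homotopy_group i (ssub X (rad_cot n X)) \<cong> homotopy_group i (ssub X (rad_cosk (Suc n) X))"
      by (rule iso_if_common_shape[where P = "i > n", OF upper(1)[OF T(2)] piX])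
        (rule upper T | assumption)+
    then show ?thesis
      using upper(2,3)[OF T(1)[of n], of i] upper(2,3)[OF T(2)[of n], of i]
      by (auto simp: Pi_upper_cot_def Pi_upper_cosk_def Suc_eq_plus1)
  qed
  have 2: "homotopy_group i (Pi_lower_cot n X) \<cong> homotopy_group i (Pi_lower_cosk (n + 1) X) \<and>
       (if i \<ge> n + 1
        then trivial_group (homotopy_group i (Pi_lower_cot n X)) \<and>
             trivial_group (homotopy_group i (Pi_lower_cosk (n + 1) X))
        else homotopy_group i (Pi_lower_cot n X) \<cong> homotopy_group i X \<and>
             homotopy_group i (Pi_lower_cosk (n + 1) X) \<cong> homotopy_group i X)" for n i
  proof -
    have "homotopy_group i (squot X (rad_cot n X)) \<cong> homotopy_group i (squot X (rad_cosk (Suc n) X))"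
      by (rule iso_if_common_shape[where P = "\<not> i > n", OF lower(1)[OF T(2)] piX])
        (rule lower T | assumption | erule notnotD)+
    then show ?thesis
      using lower(2,3)[OF T(1)[of n], of i] lower(2,3)[OF T(2)[of n], of i]
      by (auto simp: Pi_lower_cot_def Pi_lower_cosk_def Suc_eq_plus1)
  qed
  \<comment> \<open>Numerator and denominator both cut at \<open>n\<close>, so no degree
    survives.\<close>
  have 3: "trivial_group (homotopy_group i (Pi_cot_cosk n (n + 1) X))" for n i
    using homotopy_group_rad_quot(3)[OF T(1)[of n] T(2)[of n] rad_cosk_subset_rad_cot]
    by (simp add: Pi_cot_cosk_def Suc_eq_plus1)
  \<comment> \<open>These inclusions discharge the containment premise of
    \<open>homotopy_group_rad_quot\<close> and leave only \<open>n < m\<close>.\<close>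
  note sub = cuts_subset[OF T(1) T(1)] cuts_subset[OF T(1) T(2)] cuts_subset[OF T(2) T(1)]
    cuts_subset[OF T(2) T(2)]
  note cot_cosk = homotopy_group_rad_quot[OF T(1) T(2) sub(2), folded Pi_cot_cosk_def]
  note cot_cot = homotopy_group_rad_quot[OF T(1) T(1) sub(1), folded Pi_cot_cot_def]
  note cosk_cosk = homotopy_group_rad_quot[OF T(2) T(2) sub(4), folded Pi_cosk_cosk_def]
  note cosk_cot = homotopy_group_rad_quot[OF T(2) T(1) sub(3), folded Pi_cosk_cot_def]
  have 4: "if m + 1 > i \<and> i \<ge> n + 1
        then homotopy_group i (Pi_cot_cosk n (m + 1) X) \<cong> homotopy_group i X
        else trivial_group (homotopy_group i (Pi_cot_cosk n (m + 1) X))" if "m > n" for n m i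
    using cot_cosk(2,3)[OF that, of i] by (auto simp: Suc_eq_plus1)
  have 5: "homotopy_group i (Pi_cot_cosk n (m + 1) X) \<cong> homotopy_group i (Pi_cot_cot n m X) \<and>
       homotopy_group i (Pi_cot_cot n m X) \<cong> homotopy_group i (Pi_cosk_cosk (n + 1) (m + 1) X) \<and>
       homotopy_group i (Pi_cosk_cosk (n + 1) (m + 1) X) \<cong> homotopy_group i (Pi_cosk_cot (n + 1) m X)"
    if nm: "m > n" for n m i
  proof -
    note iso = iso_if_common_shape[where P = "n < i \<and> i \<le> m", OF _ piX[of i]]
    show ?thesis
      unfolding Suc_eq_plus1[symmetric]
      by (intro conjI
          iso[OF cot_cot(1)[OF nm] cot_cosk(2,3)[OF nm] cot_cot(2,3)[OF nm]]
          iso[OF cosk_cosk(1)[OF nm] cot_cot(2,3)[OF nm] cosk_cosk(2,3)[OF nm]]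
          iso[OF cosk_cot(1)[OF nm] cosk_cosk(2,3)[OF nm] cosk_cot(2,3)[OF nm]])
        simp_all
  qed
  have 6: "if i = n + 1
        then homotopy_group i (Pi_cot_cosk n (n + 2) X) \<cong> homotopy_group i X
        else trivial_group (homotopy_group i (Pi_cot_cosk n (n + 2) X))" for n i
  proof -
    \<comment> \<open>The fourth statement at \<open>m = n + 1\<close>, where the surviving range is
      a single degree.\<close>
    have two: "n + 1 + 1 = n + 2" and idx: "n + 2 > i \<and> i \<ge> n + 1 \<longleftrightarrow> i = n + 1" by auto
    have "n + 1 > n" by simp
    from 4[OF this, of i] show ?thesis unfolding two idx .
  qed
  show ?thesis
    by (rule conjI, intro allI, rule 1, rule conjI, intro allI, rule 2, rule conjI, intro allI,
        rule 3, rule conjI, intro allI impI, rule 4, assumption, rule conjI, intro allI impI,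
        rule 5, assumption, intro allI, rule 6)
qed

end
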